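(* Let $\mu$ be a probability measure on $\mathbb{C}$ and let $\{z_{n,i}\}_{n\ge1,1\le i\le n}$ be a (deterministic) $\mu$-distributed triangular array of complex numbers. Fix $k\in\mathbb{N}$. For each $n\in\mathbb{N}$ let $(X_{n,1},\dots,X_{n,k})$ be a complex-valued random vector with joint probability density $\nu_n(w_1,\dots,w_k)$ on $\mathbb{C}^k$. Suppose there exist constants $C_1,C_2>0$ and $a\in[0,1)$, not depending on $n$ and $i$, such that for all $n\in\mathbb{N}$ and all $1\le i\le k$: (1) $\displaystyle\int_{\mathbb{C}^k}\sum_{j=1}^k\log_+|w_j|\,\nu_n(w_1,\dots,w_k)\,dw_1\cdots dw_k\le C_1<\infty$; (2) $\displaystyle\frac{\sup_{w_i\in\mathbb{C}}\nu_n(w_1,\dots,w_k)}{\int_{\mathbb{C}}\nu_n(w_1,\dots,w_k)\,dw_i}\le C_2\exp(n^a)$ for all $w_1,\dots,w_{i-1},w_{i+1},\dots,w_k\in\mathbb{C}$; and moreover (3) $\displaystyle\lim_{r\to\infty}\limsup_{n\to\infty}\mathbf{P}\Big(\max_{1\le j\le k}|X_{n,j}|\ge r\Big)=0$. Let $$P_n(z):=(z-z_{n,1})\cdots(z-z_{n,n})(z-X_{n,1})\cdots(z-X_{n,k}).$$ Then, as $n\to\infty$, $\mathcal{M}(P_n)\to\mu$ in probability and $\mathcal{M}(P_n^{(\ell)})\to\mu$ in probability for any $1\le\ell\le k$.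
   Context: A triangular array $\{z_{n,i}\}_{n\ge1;1\le i\le n}$ of complex numbers is $\mu$-distributed if $\frac1n\sum_{i=1}^n\delta_{z_{n,i}}$ converges weakly to the probability measure $\mu$ as $n\to\infty$. $\log_+x=\max(\log x,0)$ (and $\log_+0=0$). Densities are with respect to Lebesgue measure. Condition (2) says that the conditional density of the $i$-th coordinate given the other coordinates is bounded by $C_2\exp(n^a)$. For a non-constant polynomial $P$, $\mathcal{M}(P)$ denotes the uniform probability measure on the multiset of zeros of $P$ (zeros counted with multiplicity). $P_n^{(\ell)}$ is the $\ell$-th derivative. Convergence in probability of random probability measures is with respect to the topology of weak convergence of probability measures on $\mathbb{C}$. *)

theory Defs
  imports "HOL-Probability.Probability" "HOL-Computational_Algebra.Computational_Algebra"
begin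

(* Uniform probability measure on a nonempty multiset, elements weighted by multiplicity,
   regarded as a Borel measure; unspecified for the empty multiset. *)
definition unif_measure :: "'a::topological_space multiset \<Rightarrow> 'a measure" where
  "unif_measure A = distr (measure_pmf (pmf_of_multiset A)) borel (\<lambda>x. x)"

definition zeros_measure :: "complex poly \<Rightarrow> complex measure" where
  "zeros_measure p = unif_measure (proots p)"

definition weakly_converges ::
    "(nat \<Rightarrow> 'a::topological_space measure) \<Rightarrow> 'a measure \<Rightarrow> bool" where
  "weakly_converges N \<mu> \<longleftrightarrow>
     (\<forall>f::'a \<Rightarrow> real. continuous_on UNIV f \<and> bounded (range f) \<longrightarrow>
        (\<lambda>n. \<integral>x. f x \<partial>N n) \<longlonglongrightarrow> (\<integral>x. f x \<partial>\<mu>))"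

(* Rows are indexed by n \<ge> 1 with entries z n 1, ..., z n n; the values of z elsewhere are
   irrelevant. *)
definition mu_distributed :: "complex measure \<Rightarrow> (nat \<Rightarrow> nat \<Rightarrow> complex) \<Rightarrow> bool" where
  "mu_distributed \<mu> z \<longleftrightarrow>
     weakly_converges (\<lambda>n. unif_measure (image_mset (z n) (mset_set {1..n}))) \<mu>"

(* The topology of weak convergence on the set of Borel probability measures: the coarsest one
   for which integration against each bounded continuous real function is continuous. *)
definition weak_topology :: "'a::topological_space measure topology" where
  "weak_topology = topology_generated_by
     {{N \<in> space (prob_algebra borel). (\<integral>x. f x \<partial>N) \<in> V} | (f :: 'a \<Rightarrow> real) V.
        continuous_on UNIV f \<and> bounded (range f) \<and> open V}"

(* Convergence in probability of T-valued random elements to a constant. The n-th element may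
   live on its own probability space M n. Outer measure is the probability whenever the event is
   measurable; it is used because emeasure would be 0 on a non-measurable set. *)
definition converges_in_prob ::
    "'b topology \<Rightarrow> (nat \<Rightarrow> 'a measure) \<Rightarrow> (nat \<Rightarrow> 'a \<Rightarrow> 'b) \<Rightarrow> 'b \<Rightarrow> bool" where
  "converges_in_prob T M \<xi> x \<longleftrightarrow>
     x \<in> topspace T \<and>
     (\<forall>U. openin T U \<and> x \<in> U \<longrightarrow>
        (\<lambda>n. outer_measure_of (M n) {\<omega> \<in> space (M n). \<xi> n \<omega> \<notin> U}) \<longlonglongrightarrow> 0)"

definition log_plus :: "real \<Rightarrow> real" where
  "log_plus x = (if x = 0 then 0 else max (ln x) 0)"

definition perturbed_poly ::
    "nat \<Rightarrow> nat \<Rightarrow> (nat \<Rightarrow> complex) \<Rightarrow> (nat \<Rightarrow> complex) \<Rightarrow> complex poly" where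
  "perturbed_poly n k z x = (\<Prod>i=1..n. [:- z i, 1:]) * (\<Prod>j=1..k. [:- x j, 1:])"

lemma sum_mset_count_aux:
  "(\<Sum>x\<in>#A. f x) = (\<Sum>x\<in>set_mset A. real (count A x) * f x)"
proof (induction A)
  case (add a A)
  have "(\<Sum>x\<in>set_mset (add_mset a A). real (count (add_mset a A) x) * f x)
      = (\<Sum>x\<in>insert a (set_mset A). real (count A x) * f x + (if x = a then f x else 0))"
    by (intro sum.cong) (auto simp: algebra_simps)
  also have "\<dots> = (\<Sum>x\<in>insert a (set_mset A). real (count A x) * f x) + f a"
    by (simp add: sum.distrib)
  also have "(\<Sum>x\<in>insert a (set_mset A). real (count A x) * f x)
      = (\<Sum>x\<in>set_mset A. real (count A x) * f x)"
    by (intro sum.mono_neutral_right) (auto simp: not_in_iff)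
  finally show ?case using add.IH by simp
qed simp

lemma integral_unif_measure:
  fixes f :: "'a::topological_space \<Rightarrow> real"
  assumes "A \<noteq> {#}" and "f \<in> borel_measurable borel"
  shows "(\<integral>x. f x \<partial>unif_measure A) = (\<Sum>x\<in>#A. f x) / size A"
proof -
  have "(\<integral>x. f x \<partial>unif_measure A) = (\<integral>x. f x \<partial>measure_pmf (pmf_of_multiset A))"
    unfolding unif_measure_def using assms(2) by (subst integral_distr) auto
  also have "\<dots> = (\<Sum>x\<in>set_mset A. pmf (pmf_of_multiset A) x * f x)"
    using assms(1) by (subst integral_measure_pmf[of "set_mset A"]) auto
  also have "\<dots> = (\<Sum>x\<in>#A. f x) / size A"
    by (simp add: assms(1) sum_divide_distrib sum_mset_count_aux)
  finally show ?thesis .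
qed

lemma topspace_weak_topology:
  "topspace (weak_topology :: 'a::topological_space measure topology) = space (prob_algebra borel)"
    (is "_ = ?S")
proof -
  have "?S \<in> {{N \<in> ?S. (\<integral>x. f x \<partial>N) \<in> V} | (f :: 'a \<Rightarrow> real) V.
        continuous_on UNIV f \<and> bounded (range f) \<and> open V}"
    by (rule CollectI, rule exI[of _ "\<lambda>_. 0"], rule exI[of _ UNIV]) (auto simp: image_def)
  then show ?thesis
    unfolding weak_topology_def topology_generated_by_topspace by auto
qed

lemma limitin_weak_topology_iff:
  fixes \<mu> :: "'a::topological_space measure"
  assumes "\<mu> \<in> space (prob_algebra borel)"
    and ev: "eventually (\<lambda>n. N n \<in> space (prob_algebra borel)) sequentially"
  shows "limitin weak_topology N \<mu> sequentially \<longleftrightarrow> weakly_converges N \<mu>"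
proof
  assume L: "limitin weak_topology N \<mu> sequentially"
  show "weakly_converges N \<mu>"
    unfolding weakly_converges_def tendsto_def
  proof (intro allI impI)
    fix f :: "'a \<Rightarrow> real" and V
    assume f: "continuous_on UNIV f \<and> bounded (range f)" and V: "open V" "(\<integral>x. f x \<partial>\<mu>) \<in> V"
    have "openin weak_topology {N \<in> space (prob_algebra borel). (\<integral>x. f x \<partial>N) \<in> V}"
      unfolding weak_topology_def using f V by (intro topology_generated_by_Basis) blast
    from limitinD[OF L this] show "eventually (\<lambda>n. (\<integral>x. f x \<partial>N n) \<in> V) sequentially"
      using V assms(1) by (auto elim: eventually_mono)
  qed
next
  assume W: "weakly_converges N \<mu>"
  have "eventually (\<lambda>n. N n \<in> U) sequentially"
    if "openin weak_topology U" "\<mu> \<in> U" for U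
    using openin_topology_generated_by[OF that(1)[unfolded weak_topology_def]] that(2)
  proof (induction rule: generate_topology_on.induct)
    case (Int a b)
    then show ?case by (auto intro: eventually_conj)
  next
    case (UN K)
    then obtain S where S: "S \<in> K" "\<mu> \<in> S" by auto
    then have "eventually (\<lambda>n. N n \<in> S) sequentially" using UN.IH by auto
    then show ?case by eventually_elim (use S in auto)
  next
    case (Basis s)
    then obtain f :: "'a \<Rightarrow> real" and V where s: "s = {N \<in> space (prob_algebra borel). (\<integral>x. f x \<partial>N) \<in> V}"
      and fV: "continuous_on UNIV f" "bounded (range f)" "open V" by blast
    have "eventually (\<lambda>n. (\<integral>x. f x \<partial>N n) \<in> V) sequentially"
      using W fV Basis s unfolding weakly_converges_def tendsto_def by auto
    with ev show ?case unfolding s by eventually_elim auto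
  qed simp
  then show "limitin weak_topology N \<mu> sequentially"
    unfolding limitin_def topspace_weak_topology using assms(1) by auto
qed

end

(* Put L = P^(l) / P. Jensen's formula on circles expresses the difference of a linear statistic of
   the zeros of P^(l) and of P, for suitable smoothed test functions, through integrals of ln |L|; the k
   random zeros themselves are negligible. So it suffices that the integral of |ln |L|| over a disc
   has expectation o(n). The positive part is deterministically O(ln n), because L is a product of
   logarithmic derivatives. For the negative part, write P = (x - X) G; then
   P^(l) / P = l (G^(l-1) / G) (1 / (x - X) + y) where y does not involve X, so the bounded
   conditional density of X together with its logarithmic moment gives a bound O(n^a) for the expected
   negative part of ln |1 / (x - X) + y|, and one recurses on G and l - 1. *)

theory Submission
  imports Defs "HOL-Complex_Analysis.Complex_Analysis" "HOL-Real_Asymp.Real_Asymp"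
begin

subsection \<open>Logarithmic derivatives\<close>


text \<open>Convergence of ln |L| at chosen points would need a lower bound there, where L may be
  tiny or vanish. Averaging over the centres of the circles as well as along each circle leaves only
  an area integral, for which a bound in expectation suffices. Circles of radii r and 2 r about the
  same centre are paired: in the difference of the two formulas the leading coefficients cancel, and
  the remaining kernel has compact support. The obstacle is that the conditional density may be as
  large as exp (n^a). The negative logarithm is therefore truncated at a level s: values above exp
  (- s) cost at most s, smaller values cost a multiple of exp (n^a) exp (- 2 s), because 1 / |z| is
  integrable in the plane with integral of order \<rho> over a disc of radius \<rho>. The choice s =
  n^a makes the total O(n^a), which is o(n) as a < 1. Each derivative uses up one random factor, so
  l \<le> k lets the recursion end at a quotient equal to 1.\<close>

text \<open>As \<open>ln 0 = 0\<close>, the value at 0 is 0 and not infinite; arguments that need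
  the true logarithm must exclude the zeros, which is done almost everywhere.\<close>

abbreviation log_minus :: "real \<Rightarrow> real" where
  "log_minus x \<equiv> max 0 (- ln x)"

lemma log_plus_eq: "log_plus x = max 0 (ln x)"
  by (simp add: log_plus_def max.commute)

lemma poly_borel_measurable [measurable]: "poly (p :: complex poly) \<in> borel_measurable borel"
  by (intro borel_measurable_continuous_onI continuous_intros)

lemma cball_measurable [measurable]: "cball (c :: complex) r \<in> sets borel"
  by simp

lemma AE_poly_nonzero:
  assumes "(p :: complex poly) \<noteq> 0"
  shows "AE z in lborel. poly p z \<noteq> 0"
  using finite_imp_null_set_lborel[OF poly_roots_finite[OF assms]]
  by (intro AE_I[where N = "{z. poly p z = 0}"]) (auto simp: null_sets_def)

lemma emeasure_cball_complex: "0 \<le> r \<Longrightarrow> emeasure lborel (cball (c :: complex) r) = ennreal (pi * r\<^sup>2)"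
  by (simp add: emeasure_cball unit_ball_vol_2)

text \<open>Dyadic decomposition: where the distance to \<open>w\<close> lies between
  \<open>\<rho> / 2 ^ Suc j\<close> and \<open>\<rho> / 2 ^ j\<close>, the kernel is at most
  \<open>2 ^ Suc j\<close>, which the \<open>j\<close>-th summand alone supplies. The areas decay
  like 4^(-j), so the series is geometric. The factor \<rho> squared is what later beats a large
  density bound.\<close>

lemma nn_integral_inverse_norm_le:
  fixes w :: complex
  assumes "0 < \<rho>"
  shows "(\<integral>\<^sup>+ z. ennreal (\<rho> / norm (z - w)) * indicator (cball w \<rho>) z \<partial>lborel) \<le> ennreal (4 * pi * \<rho>\<^sup>2)"
proof -
  let ?B = "\<lambda>j::nat. cball w (\<rho> / 2 ^ j)"
  have pt: "ennreal (\<rho> / norm (z - w)) * indicator (cball w \<rho>) z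
      \<le> (\<Sum>j. ennreal (2 ^ Suc j) * indicator (?B j) z)" for z
  proof (cases "z \<noteq> w \<and> z \<in> cball w \<rho>")
    case True
    define t where "t = norm (z - w)"
    have t: "0 < t" "t \<le> \<rho>" using True by (auto simp: t_def dist_norm norm_minus_commute)
    obtain N where "\<rho> / t < 2 ^ N" using real_arch_pow[of 2 "\<rho> / t"] by auto
    then have "\<rho> / 2 ^ N < t" using t by (simp add: field_simps)
    moreover have "\<not> \<rho> / 2 ^ 0 < t" using t by simp
    ultimately obtain j where j: "\<not> \<rho> / 2 ^ j < t" "\<rho> / 2 ^ Suc j < t"
      using ex_least_nat_less[of "\<lambda>n. \<rho> / 2 ^ n < t" N] by blast
    have "\<rho> / t \<le> 2 ^ Suc j" using j t by (simp add: field_simps)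
    then have "ennreal (\<rho> / norm (z - w)) * indicator (cball w \<rho>) z \<le> ennreal (2 ^ Suc j) * indicator (?B j) z"
      using j True by (auto simp: t_def dist_norm norm_minus_commute indicator_def intro!: ennreal_leI split: if_splits)
    also have "\<dots> \<le> (\<Sum>j. ennreal (2 ^ Suc j) * indicator (?B j) z)"
    proof -
      have "f j \<le> (\<Sum>j. f j)" for f :: "nat \<Rightarrow> ennreal"
        using sum_le_suminf[of f "{j}"] by simp
      then show ?thesis .
    qed
    finally show ?thesis .
  qed auto
  have "(\<integral>\<^sup>+ z. ennreal (\<rho> / norm (z - w)) * indicator (cball w \<rho>) z \<partial>lborel)
      \<le> (\<integral>\<^sup>+ z. (\<Sum>j. ennreal (2 ^ Suc j) * indicator (?B j) z) \<partial>lborel)"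
    by (intro nn_integral_mono pt)
  also have "\<dots> = (\<Sum>j. \<integral>\<^sup>+ z. ennreal (2 ^ Suc j) * indicator (?B j) z \<partial>lborel)"
    by (intro nn_integral_suminf) auto
  also have "\<dots> = (\<Sum>j. ennreal (4 * pi * \<rho>\<^sup>2 * (1 / 2) ^ Suc j))"
  proof (intro suminf_cong)
    fix j
    have "(\<integral>\<^sup>+ z. ennreal (2 ^ Suc j) * indicator (?B j) z \<partial>lborel) = ennreal (2 ^ Suc j) * ennreal (pi * (\<rho> / 2 ^ j)\<^sup>2)"
      using assms by (simp add: nn_integral_cmult emeasure_cball_complex)
    also have "\<dots> = ennreal (2 ^ Suc j * (pi * (\<rho> / 2 ^ j)\<^sup>2))"
      by (subst ennreal_mult) auto
    also have "2 ^ Suc j * (pi * (\<rho> / 2 ^ j)\<^sup>2) = 4 * pi * \<rho>\<^sup>2 * (1 / 2) ^ Suc j"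
      by (simp add: field_simps power2_eq_square power_one_over)
    finally show "(\<integral>\<^sup>+ z. ennreal (2 ^ Suc j) * indicator (?B j) z \<partial>lborel) = ennreal (4 * pi * \<rho>\<^sup>2 * (1 / 2) ^ Suc j)" .
  qed
  also have "\<dots> = ennreal (4 * pi * \<rho>\<^sup>2)"
    using sums_mult[OF power_half_series, of "4 * pi * \<rho>\<^sup>2"]
    by (intro suminf_ennreal_eq) auto
  finally show ?thesis .
qed

text \<open>An explicit factorisation permits induction over the zeros; the leading coefficient
  cancels in the quotient.\<close>

lemma log_deriv_prod_linear:
  fixes A :: "complex multiset"
  assumes "c \<noteq> 0" and "z \<notin># A"
  shows "poly (pderiv (smult c (\<Prod>w\<in>#A. [:- w, 1:]))) z / poly (smult c (\<Prod>w\<in>#A. [:- w, 1:])) z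
    = (\<Sum>w\<in>#A. 1 / (z - w))"
  using assms(2)
proof (induction A)
  case (add a A)
  define p where "p = smult c (\<Prod>w\<in>#A. [:- w, 1:])"
  have z: "z \<noteq> a" "z \<notin># A" using add.prems by auto
  have nz: "poly p z \<noteq> 0"
    using z(2) assms(1) by (auto simp: p_def poly_prod_mset prod_mset_zero_iff)
  have e: "smult c (\<Prod>w\<in>#add_mset a A. [:- w, 1:]) = [:- a, 1:] * p" by (simp add: p_def)
  have "poly (pderiv ([:- a, 1:] * p)) z = (z - a) * poly (pderiv p) z + poly p z"
    unfolding pderiv_mult by (simp add: pderiv_pCons algebra_simps)
  moreover have "poly ([:- a, 1:] * p) z = (z - a) * poly p z"
    by (simp add: algebra_simps)
  ultimately have "poly (pderiv ([:- a, 1:] * p)) z / poly ([:- a, 1:] * p) z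
      = 1 / (z - a) + poly (pderiv p) z / poly p z"
    using z nz by (simp add: divide_simps)
  then show ?case unfolding e using add.IH[OF z(2)] by (simp flip: p_def)
qed simp

lemma log_deriv_eq_sum_proots:
  fixes p :: "complex poly"
  assumes "poly p z \<noteq> 0"
  shows "poly (pderiv p) z / poly p z = (\<Sum>w\<in>#proots p. 1 / (z - w))"
proof -
  have p: "p \<noteq> 0" using assms by auto
  then have "z \<notin># proots p" using assms by simp
  from log_deriv_prod_linear[OF _ this, of "lead_coeff p"] show ?thesis
    using p by (simp add: complex_poly_decompose_multiset)
qed

lemma log_plus_nonneg: "0 \<le> log_plus x" by (simp add: log_plus_eq)

lemma log_plus_mono: "0 \<le> x \<Longrightarrow> x \<le> y \<Longrightarrow> log_plus x \<le> log_plus y"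
  by (cases "x = 0") (auto simp: log_plus_eq le_max_iff_disj)

lemma log_plus_mult_le: "0 \<le> x \<Longrightarrow> 0 \<le> y \<Longrightarrow> log_plus (x * y) \<le> log_plus x + log_plus y"
  by (cases "x = 0 \<or> y = 0") (auto simp: log_plus_eq ln_mult)

lemma sum_mset_nonneg:
  fixes f :: "'a \<Rightarrow> real"
  assumes "\<And>w. 0 \<le> f w"
  shows "0 \<le> (\<Sum>w\<in>#A. f w)"
  using assms by (induction A) auto

lemma norm_sum_mset_le: "norm (\<Sum>w\<in>#A. f w) \<le> (\<Sum>w\<in>#A. norm (f w))"
  by (induction A) (auto intro: norm_triangle_mono)

lemma ennreal_sum_mset:
  assumes "\<And>w. 0 \<le> f w"
  shows "ennreal (\<Sum>w\<in>#A. f w) = (\<Sum>w\<in>#A. ennreal (f w))"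
  using assms by (induction A) (simp_all add: sum_mset_nonneg)

lemma nn_integral_sum_mset:
  assumes "\<And>w. w \<in># A \<Longrightarrow> f w \<in> borel_measurable M"
  shows "(\<integral>\<^sup>+ z. (\<Sum>w\<in>#A. f w z) \<partial>M) = (\<Sum>w\<in>#A. \<integral>\<^sup>+ z. f w z \<partial>M)"
    and "(\<lambda>z. (\<Sum>w\<in>#A. f w z)) \<in> borel_measurable M"
proof -
  have "(\<integral>\<^sup>+ z. (\<Sum>w\<in>#A. f w z) \<partial>M) = (\<Sum>w\<in>#A. \<integral>\<^sup>+ z. f w z \<partial>M)
    \<and> (\<lambda>z. (\<Sum>w\<in>#A. f w z)) \<in> borel_measurable M"
    using assms by (induction A) (auto simp: nn_integral_add)
  then show "(\<integral>\<^sup>+ z. (\<Sum>w\<in>#A. f w z) \<partial>M) = (\<Sum>w\<in>#A. \<integral>\<^sup>+ z. f w z \<partial>M)"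
    and "(\<lambda>z. (\<Sum>w\<in>#A. f w z)) \<in> borel_measurable M" by auto
qed

text \<open>The tangent of \<open>ln\<close> at \<open>d\<close> lies above the graph. Taking
  \<open>max 0\<close> covers \<open>x = 0\<close>, where \<open>ln\<close> is 0 by convention, also
  for \<open>d < 1\<close>.\<close>

lemma ln_le_of_scale:
  fixes x d :: real
  assumes "0 < d" "0 \<le> x"
  shows "ln x \<le> max 0 (ln d) + x / d"
proof (cases "x = 0")
  case False
  then have "ln (x / d) \<le> x / d - 1" using assms by (intro ln_le_minus_one divide_pos_pos) auto
  then show ?thesis using assms False by (simp add: ln_div)
qed simp

text \<open>Linearising \<open>ln\<close> at the degree makes the bound depend only logarithmically on it.\<close>

lemma nn_integral_log_plus_log_deriv:
  fixes p :: "complex poly"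
  assumes d: "degree p \<ge> 1" and R: "0 \<le> R"
  shows "(\<integral>\<^sup>+ z. ennreal (log_plus (norm (poly (pderiv p) z / poly p z))) * indicator (cball 0 R) z \<partial>lborel)
     \<le> ennreal (pi * R\<^sup>2 * (ln (degree p) + 1) + 4 * pi)"
proof -
  let ?d = "real (degree p)" and ?D = "cball (0::complex) R"
  have d': "?d \<ge> 1" using d by simp
  have p: "p \<noteq> 0" using d by auto
  \<comment> \<open>Splits 1 / |z - w| at distance 1: an integrable singularity nearby, at most 1 on
    the disc otherwise. The integral is thus bounded uniformly in the position of the zero
    \<open>w\<close>.\<close>
  define F where "F = (\<lambda>w z. ennreal (1 / norm (z - w)) * indicator (cball w 1) z + indicator ?D (z::complex))"
  have mF [measurable]: "F w \<in> borel_measurable borel" for w unfolding F_def by measurable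
  have mS [measurable]: "(\<lambda>z. \<Sum>w\<in>#proots p. F w z) \<in> borel_measurable borel"
    using mF by (rule nn_integral_sum_mset(2))
  have F: "(\<integral>\<^sup>+ z. F w z \<partial>lborel) \<le> ennreal (pi * R\<^sup>2 + 4 * pi)" for w
  proof -
    have "(\<integral>\<^sup>+ z. F w z \<partial>lborel) = (\<integral>\<^sup>+ z. ennreal (1 / norm (z - w)) * indicator (cball w 1) z \<partial>lborel)
        + ennreal (pi * R\<^sup>2)"
      unfolding F_def using R by (subst nn_integral_add) (auto simp: emeasure_cball_complex)
    also have "\<dots> \<le> ennreal (4 * pi) + ennreal (pi * R\<^sup>2)"
      using nn_integral_inverse_norm_le[of 1 w] by (intro add_right_mono) simp
    finally show ?thesis by (simp add: add.commute flip: ennreal_plus)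
  qed
  have pt: "ennreal (log_plus (norm (poly (pderiv p) z / poly p z))) * indicator ?D z
      \<le> ennreal (ln ?d) * indicator ?D z + ennreal (1 / ?d) * (\<Sum>w\<in>#proots p. F w z)"
    if nz: "poly p z \<noteq> 0" for z
  proof (cases "z \<in> ?D")
    case True
    let ?S = "\<Sum>w\<in>#proots p. 1 / norm (z - w)"
    have S0: "0 \<le> ?S" by (intro sum_mset_nonneg) auto
    have nS: "norm (poly (pderiv p) z / poly p z) \<le> ?S"
      unfolding log_deriv_eq_sum_proots[OF nz] using norm_sum_mset_le[of "\<lambda>w. 1 / (z - w)" "proots p"]
      by (simp add: norm_divide)
    have "log_plus (norm (poly (pderiv p) z / poly p z)) \<le> log_plus ?S"
      by (intro log_plus_mono nS) auto
    also have "\<dots> \<le> ln ?d + ?S / ?d"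
      using ln_le_of_scale[of ?d ?S] d' S0 by (auto simp: log_plus_eq)
    finally have "ennreal (log_plus (norm (poly (pderiv p) z / poly p z))) \<le> ennreal (ln ?d) + ennreal (1 / ?d) * ennreal ?S"
      using d' S0 by (simp add: ennreal_leI flip: ennreal_plus ennreal_mult)
    also have "ennreal ?S = (\<Sum>w\<in>#proots p. ennreal (1 / norm (z - w)))"
      by (rule ennreal_sum_mset) simp
    also have "\<dots> \<le> (\<Sum>w\<in>#proots p. F w z)"
    proof (intro sum_mset_mono)
      fix w
      show "ennreal (1 / norm (z - w)) \<le> F w z"
      proof (cases "norm (z - w) \<le> 1")
        case True
        then show ?thesis by (simp add: F_def dist_norm norm_minus_commute)
      next
        case False
        then have "ennreal (1 / norm (z - w)) \<le> ennreal 1" by (intro ennreal_leI) (simp add: divide_le_eq)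
        also have "\<dots> \<le> F w z" using \<open>z \<in> ?D\<close> by (simp add: F_def)
        finally show ?thesis .
      qed
    qed
    finally show ?thesis using True by (simp add: mult_left_mono)
  qed simp
  have "(\<integral>\<^sup>+ z. ennreal (log_plus (norm (poly (pderiv p) z / poly p z))) * indicator ?D z \<partial>lborel)
      \<le> (\<integral>\<^sup>+ z. ennreal (ln ?d) * indicator ?D z + ennreal (1 / ?d) * (\<Sum>w\<in>#proots p. F w z) \<partial>lborel)"
    by (intro nn_integral_mono_AE, use AE_poly_nonzero[OF p] in eventually_elim) (rule pt)
  also have "\<dots> = ennreal (ln ?d) * ennreal (pi * R\<^sup>2) + ennreal (1 / ?d) * (\<Sum>w\<in>#proots p. \<integral>\<^sup>+ z. F w z \<partial>lborel)"
    using R by (subst nn_integral_add, measurable, subst (1 2) nn_integral_cmult, measurable)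
      (simp add: nn_integral_sum_mset emeasure_cball_complex)
  also have "\<dots> \<le> ennreal (ln ?d) * ennreal (pi * R\<^sup>2) + ennreal (1 / ?d) * (\<Sum>w\<in>#proots p. ennreal (pi * R\<^sup>2 + 4 * pi))"
    by (intro add_left_mono mult_left_mono sum_mset_mono F) auto
  also have "(\<Sum>w\<in>#proots p. ennreal (pi * R\<^sup>2 + 4 * pi)) = ennreal (?d * (pi * R\<^sup>2 + 4 * pi))"
  proof -
    have "(\<Sum>w\<in>#proots p. ennreal (pi * R\<^sup>2 + 4 * pi)) = ennreal (\<Sum>w\<in>#proots p. pi * R\<^sup>2 + 4 * pi)"
      by (rule ennreal_sum_mset[symmetric]) simp
    then show ?thesis by (simp add: size_proots_complex)
  qed
  \<comment> \<open>The number of zeros cancels against the slope \<open>1 / ?d\<close> of the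
    tangent, so the degree survives only inside \<open>ln\<close>.\<close>
  also have "ennreal (1 / ?d) * ennreal (?d * (pi * R\<^sup>2 + 4 * pi)) = ennreal (pi * R\<^sup>2 + 4 * pi)"
    using d' by (subst ennreal_mult'[symmetric]) (simp_all del: distrib_left_numeral)
  also have "ennreal (ln ?d) * ennreal (pi * R\<^sup>2) = ennreal (ln ?d * (pi * R\<^sup>2))"
    using d' by (subst ennreal_mult') auto
  also have "ennreal (ln ?d * (pi * R\<^sup>2)) + ennreal (pi * R\<^sup>2 + 4 * pi) = ennreal (pi * R\<^sup>2 * (ln ?d + 1) + 4 * pi)"
    using d' by (subst ennreal_plus[symmetric]) (auto simp: algebra_simps)
  finally show ?thesis .
qed

lemma pderiv_funpow_nonzero:
  fixes p :: "complex poly"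
  assumes "p \<noteq> 0" "m \<le> degree p"
  shows "(pderiv ^^ m) p \<noteq> 0" "degree ((pderiv ^^ m) p) = degree p - m"
proof -
  have "(pderiv ^^ m) p \<noteq> 0 \<and> degree ((pderiv ^^ m) p) = degree p - m"
    using assms by (induction m) (auto simp: degree_pderiv pderiv_eq_0_iff)
  then show "(pderiv ^^ m) p \<noteq> 0" "degree ((pderiv ^^ m) p) = degree p - m" by auto
qed

text \<open>The quotient telescopes into \<open>m\<close> successive logarithmic derivatives, and
  \<open>log_plus\<close> is subadditive on products. Degrees only drop, so the bound for
  \<open>degree p\<close> serves every factor.\<close>

lemma nn_integral_log_plus_higher_deriv:
  fixes p :: "complex poly"
  assumes "m \<le> degree p" "degree p \<ge> 1" and R: "0 \<le> R"
  shows "(\<integral>\<^sup>+ z. ennreal (log_plus (norm (poly ((pderiv ^^ m) p) z / poly p z))) * indicator (cball 0 R) z \<partial>lborel)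
     \<le> ennreal (real m * (pi * R\<^sup>2 * (ln (degree p) + 1) + 4 * pi))"
  using assms(1)
proof (induction m)
  case 0
  have "log_plus (norm (poly p z / poly p z)) = 0" for z
    by (cases "poly p z = 0") (auto simp: log_plus_eq)
  then show ?case by simp
next
  case (Suc m)
  let ?D = "cball (0::complex) R" and ?K = "pi * R\<^sup>2 * (ln (degree p) + 1) + 4 * pi"
  let ?q = "(pderiv ^^ m) p"
  have p: "p \<noteq> 0" using assms by auto
  have q: "?q \<noteq> 0" "degree ?q = degree p - m" using pderiv_funpow_nonzero[OF p, of m] Suc.prems by auto
  have K0: "0 \<le> ?K" using assms by (auto intro!: add_nonneg_nonneg mult_nonneg_nonneg)
  let ?f = "\<lambda>z. ennreal (log_plus (norm (poly (pderiv ?q) z / poly ?q z))) * indicator ?D z"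
  let ?g = "\<lambda>z. ennreal (log_plus (norm (poly ?q z / poly p z))) * indicator ?D z"
  have [measurable]: "log_plus \<in> borel_measurable borel"
    unfolding log_plus_eq[abs_def] by measurable
  have "(\<integral>\<^sup>+ z. ennreal (log_plus (norm (poly ((pderiv ^^ Suc m) p) z / poly p z))) * indicator ?D z \<partial>lborel)
     \<le> (\<integral>\<^sup>+ z. ?f z + ?g z \<partial>lborel)"
  proof (intro nn_integral_mono_AE, use AE_poly_nonzero[OF q(1)] in eventually_elim)
    case (elim z)
    have "log_plus (norm (poly (pderiv ?q) z / poly p z))
        = log_plus (norm (poly (pderiv ?q) z / poly ?q z) * norm (poly ?q z / poly p z))"
      using elim by (simp add: norm_divide)
    also have "\<dots> \<le> log_plus (norm (poly (pderiv ?q) z / poly ?q z)) + log_plus (norm (poly ?q z / poly p z))"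
      by (intro log_plus_mult_le) auto
    finally show ?case
      by (auto simp: indicator_def ennreal_leI log_plus_nonneg simp flip: ennreal_plus)
  qed
  also have "\<dots> = (\<integral>\<^sup>+ z. ?f z \<partial>lborel) + (\<integral>\<^sup>+ z. ?g z \<partial>lborel)"
    by (intro nn_integral_add) measurable
  also have "\<dots> \<le> ennreal ?K + ennreal (real m * ?K)"
  proof (intro add_mono)
    have "(\<integral>\<^sup>+ z. ?f z \<partial>lborel) \<le> ennreal (pi * R\<^sup>2 * (ln (degree ?q) + 1) + 4 * pi)"
      using q Suc.prems R by (intro nn_integral_log_plus_log_deriv) auto
    also have "\<dots> \<le> ennreal ?K"
      using q Suc.prems by (intro ennreal_leI add_mono mult_left_mono) auto
    finally show "(\<integral>\<^sup>+ z. ?f z \<partial>lborel) \<le> ennreal ?K" .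
    show "(\<integral>\<^sup>+ z. ?g z \<partial>lborel) \<le> ennreal (real m * ?K)" using Suc by simp
  qed
  also have "\<dots> = ennreal (?K + real m * ?K)"
    using K0 by (intro ennreal_plus[symmetric] mult_nonneg_nonneg) auto
  also have "?K + real m * ?K = real (Suc m) * ?K"
    by (simp add: algebra_simps)
  finally show ?case .
qed

subsection \<open>Anti-concentration\<close>


lemma log_plus_measurable [measurable]: "log_plus \<in> borel_measurable borel"
  unfolding log_plus_eq[abs_def] by measurable

lemma log_plus_diff_le:
  fixes x y :: complex
  shows "log_plus (norm (x - y)) \<le> log_plus (norm x) + log_plus (norm y) + ln 2"
proof -
  have "log_plus (norm (x - y)) \<le> log_plus (2 * max (norm x) (norm y))"
    using norm_triangle_ineq4[of x y] by (intro log_plus_mono) auto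
  also have "\<dots> \<le> ln 2 + log_plus (max (norm x) (norm y))"
    using log_plus_mult_le[of 2 "max (norm x) (norm y)"] by (simp add: log_plus_eq[of 2] le_max_iff_disj)
  also have "log_plus (max (norm x) (norm y)) \<le> log_plus (norm x) + log_plus (norm y)"
    using log_plus_nonneg[of "norm x"] log_plus_nonneg[of "norm y"] by (auto simp: max_def)
  finally show ?thesis by simp
qed

lemma log_minus_mult_le:
  "0 \<le> x \<Longrightarrow> 0 \<le> y \<Longrightarrow> log_minus (x * y) \<le> log_minus x + log_minus y"
  by (cases "x = 0 \<or> y = 0") (auto simp: ln_mult)

text \<open>Since \<open>ln 0 = 0\<close> and \<open>1 / 0 = 0\<close>, the bound also holds when \<open>1 / u + y = 0\<close> or \<open>y = 0\<close>.\<close>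

lemma log_minus_inverse_add_le:
  fixes u y :: complex
  assumes u: "u \<noteq> 0"
  shows "log_minus (norm (1 / u + y)) \<le> 2 * log_plus (norm u) + ln 2 + log_minus (norm (u + 1 / y))"
proof (cases "y = 0 \<or> 1 / u + y = 0")
  case True
  have "log_minus (norm (1 / u)) = log_plus (norm u)"
    using u by (simp add: norm_divide ln_div log_plus_eq)
  then have "log_minus (norm (1 / u + y)) \<le> log_plus (norm u)"
    using True log_plus_nonneg[of "norm u"] by auto
  moreover have "0 \<le> log_plus (norm u)" "0 \<le> log_minus (norm (u + 1 / y))" "0 \<le> ln (2 :: real)"
    by (auto simp: log_plus_nonneg)
  ultimately show ?thesis by linarith
next
  case False
  define a b s where "a = norm u" and "b = norm (1 / y)" and "s = norm (u + 1 / y)"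
  \<comment> \<open>After factoring, the dangerous small term is \<open>u + 1 / y\<close>, which is
    a distance from a random point to a fixed one once \<open>u\<close> is
    \<open>x - X\<close>.\<close>
  have eq: "1 / u + y = (u + 1 / y) / (u * (1 / y))" using u False by (simp add: field_simps)
  have "u + 1 / y \<noteq> 0" using False eq by auto
  then have pos: "0 < a" "0 < b" "0 < s" using u False by (auto simp: a_def b_def s_def)
  have W: "norm (1 / u + y) = s / (a * b)"
    unfolding eq a_def b_def s_def by (simp only: norm_divide norm_mult)
  have ln: "- ln (s / (a * b)) = ln a + ln b - ln s"
    using pos by (simp add: ln_div ln_mult)
  have la: "ln a \<le> log_plus a" "0 \<le> log_plus a" by (auto simp: log_plus_eq)
  have "- ln (s / (a * b)) \<le> 2 * log_plus a + ln 2 + log_minus s"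
  \<comment> \<open>A large \<open>b\<close> must be compensated. Either it is comparable to
    \<open>a\<close> and paid for by a second \<open>log_plus a\<close>, or it dominates
    \<open>a\<close>; then \<open>s\<close> is at least \<open>b / 2\<close> and the two logarithms
    cancel.\<close>
  proof (cases "b \<le> 2 * a")
    case True
    then have "ln b \<le> ln (2 * a)" using pos by simp
    also have "\<dots> = ln 2 + ln a" using pos by (simp add: ln_mult)
    finally show ?thesis unfolding ln using la by linarith
  next
    case False
    have "b \<le> s + a"
      using norm_triangle_ineq4[of "u + 1 / y" u] by (simp add: a_def b_def s_def)
    then have "b \<le> 2 * s" using False by linarith
    then have "ln b \<le> ln (2 * s)" using pos by simp
    also have "\<dots> = ln 2 + ln s" using pos by (simp add: ln_mult)
    finally show ?thesis unfolding ln using la by linarith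
  qed
  then show ?thesis unfolding W using la by (simp add: a_def s_def)
qed

text \<open>Trades the logarithmic singularity for a constant and an inverse-distance kernel on a
  disc of radius \<open>exp (- s)\<close>, using \<open>ln t \<le> t - 1\<close> at
  \<open>t = exp (- s) / x\<close>. The level \<open>s\<close> stays free until the density bound is
  known.\<close>

lemma log_minus_truncate:
  assumes "0 \<le> x" "0 \<le> s"
  shows "log_minus x \<le> s + (if x \<le> exp (- s) then exp (- s) / x else 0)"
proof (cases "x = 0")
  case False
  then have x: "0 < x" using assms by simp
  have "ln (exp (- s) / x) \<le> exp (- s) / x - 1" using x by (intro ln_le_minus_one) auto
  then have 1: "- ln x \<le> s + exp (- s) / x" using x by (simp add: ln_div)
  have 2: "- ln x \<le> s" if "\<not> x \<le> exp (- s)"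
    using that x ln_mono[of "exp (- s)" x] by simp
  show ?thesis using 1 2 assms x by auto
qed (use assms in simp)

section \<open>Derivatives of a product when one linear factor is split off\<close>

lemma pderiv_linear_mult: "pderiv ([:- a, 1:] * p) = [:- a, 1:] * pderiv p + (p :: complex poly)"
  unfolding pderiv_mult by (simp add: pderiv_pCons)

lemma pderiv_of_nat_mult: "pderiv (of_nat n * p) = of_nat n * pderiv (p :: complex poly)"
  by (induction n) (simp_all add: distrib_right pderiv_add)

text \<open>Leibniz rule: the second derivative of a linear factor vanishes, so two terms
  remain.\<close>

lemma higher_pderiv_linear_mult:
  "(pderiv ^^ Suc m) ([:- a, 1:] * p) = [:- a, 1:] * (pderiv ^^ Suc m) p + of_nat (Suc m) * (pderiv ^^ m) (p :: complex poly)"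
proof (induction m)
  case 0
  then show ?case unfolding funpow.simps comp_apply id_apply pderiv_linear_mult by simp
next
  case (Suc m)
  have "(pderiv ^^ Suc (Suc m)) ([:- a, 1:] * p) = pderiv ([:- a, 1:] * (pderiv ^^ Suc m) p + of_nat (Suc m) * (pderiv ^^ m) p)"
    using Suc by simp
  also have "\<dots> = [:- a, 1:] * (pderiv ^^ Suc (Suc m)) p + (1 + of_nat (Suc m)) * (pderiv ^^ Suc m) p"
    unfolding pderiv_add pderiv_linear_mult pderiv_of_nat_mult distrib_right funpow.simps comp_apply by simp
  finally show ?case by (simp only: of_nat_Suc)
qed

lemma perturbed_poly_Suc:
  "perturbed_poly n (Suc j) z w = [:- w (Suc j), 1:] * perturbed_poly n j z w"
  by (simp add: perturbed_poly_def prod.nat_ivl_Suc' mult_ac del: mult_pCons_left)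

text \<open>Coordinates outside \<open>{1..j}\<close> may be changed freely. This gives the
  independence of the shift from the next coordinate, and lets vectors restricted to
  \<open>{1..k}\<close> replace unrestricted ones.\<close>

lemma perturbed_poly_cong:
  "(\<And>i. 1 \<le> i \<Longrightarrow> i \<le> j \<Longrightarrow> w i = w' i) \<Longrightarrow> perturbed_poly n j z w = perturbed_poly n j z w'"
  by (simp add: perturbed_poly_def)

lemma perturbed_poly_nonzero: "perturbed_poly n j z w \<noteq> 0"
  by (simp add: perturbed_poly_def)

lemma degree_perturbed_poly: "degree (perturbed_poly n j z w) = n + j"
proof -
  have "degree (\<Prod>i\<in>A. [:- x i, 1:]) = card A" if "finite A" for A :: "nat set" and x :: "nat \<Rightarrow> complex"
    by (subst degree_prod_sum_eq) auto
  then show ?thesis unfolding perturbed_poly_def by (subst degree_mult_eq) auto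
qed

lemma proots_perturbed_poly:
  "proots (perturbed_poly n k z w) = image_mset z (mset_set {1..n}) + image_mset w (mset_set {1..k})"
proof -
  have "proots (\<Prod>i\<in>A. [:- x i, 1:]) = image_mset x (mset_set A)" if "finite A" for A :: "nat set" and x :: "nat \<Rightarrow> complex"
    using that by (induction A) (auto simp: proots_mult simp del: mult_pCons_left)
  then show ?thesis unfolding perturbed_poly_def by (subst proots_mult) auto
qed

text \<open>Joint measurability in coefficients and argument, as Fubini requires. Differentiation
  acts on the whole polynomial, so the induction on \<open>j\<close> is over all \<open>m\<close> at
  once, with the Leibniz recursion reducing every derivative to those of fewer factors.\<close>

lemma poly_perturbed_poly_measurable:
  assumes "{1..j} \<subseteq> I"
  shows "(\<lambda>y. poly ((pderiv ^^ m) (perturbed_poly n j z (fst y))) (snd y))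
     \<in> borel_measurable (PiM I (\<lambda>_. lborel) \<Otimes>\<^sub>M lborel)"
  using assms
proof (induction j arbitrary: m)
  case 0
  then show ?case by (simp add: perturbed_poly_def)
next
  case (Suc j)
  have IH [measurable]: "(\<lambda>y. poly ((pderiv ^^ m) (perturbed_poly n j z (fst y))) (snd y))
     \<in> borel_measurable (PiM I (\<lambda>_. lborel) \<Otimes>\<^sub>M lborel)" for m
    using Suc.prems by (intro Suc.IH) auto
  have [measurable]: "(\<lambda>y. fst y (Suc j)) \<in> borel_measurable (PiM I (\<lambda>_. lborel :: complex measure) \<Otimes>\<^sub>M (lborel :: complex measure))"
  proof -
    have "(\<lambda>w. w (Suc j)) \<in> PiM I (\<lambda>_. lborel :: complex measure) \<rightarrow>\<^sub>M lborel"
      using Suc.prems by (intro measurable_component_singleton) auto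
    then have "(\<lambda>y. (fst y) (Suc j)) \<in> PiM I (\<lambda>_. lborel :: complex measure) \<Otimes>\<^sub>M (lborel :: complex measure) \<rightarrow>\<^sub>M lborel"
      by (rule measurable_compose[OF measurable_fst])
    then show ?thesis by simp
  qed
  show ?case
  proof (cases m)
    case 0
    then show ?thesis unfolding perturbed_poly_Suc using IH[of 0] by simp
  next
    case (Suc m')
    show ?thesis unfolding Suc perturbed_poly_Suc higher_pderiv_linear_mult
      by (simp del: funpow.simps mult_pCons_left)
  qed
qed

text \<open>The shift \<open>of_nat (Suc m) * Q w j m / Q w j (Suc m)\<close> does not involve \<open>w (Suc j)\<close>, so it is a constant
  for the conditional law of that coordinate.\<close>

lemma log_minus_deriv_quotient_step:
  fixes x :: complex and z w :: "nat \<Rightarrow> complex" and n :: nat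
  defines "Q \<equiv> \<lambda>w j m. poly ((pderiv ^^ m) (perturbed_poly n j z w)) x"
  assumes nz: "Q w j 0 \<noteq> 0" "Q w j m \<noteq> 0" and xw: "x \<noteq> w (Suc j)"
  shows "log_minus (norm (Q w (Suc j) (Suc m) / Q w (Suc j) 0)) \<le> log_minus (norm (Q w j m / Q w j 0))
     + (2 * log_plus (norm (x - w (Suc j))) + ln 2
        + log_minus (norm (x - w (Suc j) + of_nat (Suc m) * Q w j m / Q w j (Suc m))))"
proof -
  let ?u = "x - w (Suc j)" and ?y = "Q w j (Suc m) / (of_nat (Suc m) * Q w j m)"
  have u: "?u \<noteq> 0" using xw by simp
  have m: "(of_nat (Suc m) :: complex) \<noteq> 0" by (rule of_nat_neq_0)
  have quot: "(u * q1 + c * q0) / (u * g) = c * (1 / u + q1 / (c * q0)) * (q0 / g)"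
    if "u \<noteq> 0" "c \<noteq> 0" "q0 \<noteq> 0" "g \<noteq> 0" for u c q0 q1 g :: complex
    using that by (simp add: field_simps)
  have "Q w (Suc j) (Suc m) = ?u * Q w j (Suc m) + of_nat (Suc m) * Q w j m"
    unfolding Q_def perturbed_poly_Suc higher_pderiv_linear_mult
    by (simp del: funpow.simps mult_pCons_left of_nat_Suc)
  moreover have "Q w (Suc j) 0 = ?u * Q w j 0"
    by (simp add: Q_def perturbed_poly_Suc algebra_simps)
  ultimately have "Q w (Suc j) (Suc m) / Q w (Suc j) 0 = of_nat (Suc m) * (1 / ?u + ?y) * (Q w j m / Q w j 0)"
    using quot[OF u m nz(2) nz(1)] by simp
  then have "log_minus (norm (Q w (Suc j) (Suc m) / Q w (Suc j) 0))
      = log_minus (real (Suc m) * norm (1 / ?u + ?y) * norm (Q w j m / Q w j 0))"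
    by (simp only: norm_mult norm_of_nat)
  also have "\<dots> \<le> log_minus (real (Suc m)) + log_minus (norm (1 / ?u + ?y)) + log_minus (norm (Q w j m / Q w j 0))"
    by (intro order.trans[OF log_minus_mult_le] add_right_mono log_minus_mult_le) auto
  also have "log_minus (real (Suc m)) = 0" by simp
  also have "log_minus (norm (1 / ?u + ?y)) \<le> 2 * log_plus (norm ?u) + ln 2 + log_minus (norm (?u + 1 / ?y))"
    by (rule log_minus_inverse_add_le[OF u])
  also have "1 / ?y = of_nat (Suc m) * Q w j m / Q w j (Suc m)" by simp
  finally show ?thesis by simp
qed

section \<open>Expectations under a bounded conditional density\<close>

lemma inverse_norm_measurable:
  fixes c :: complex
  shows "(\<lambda>t. ennreal (\<rho> / norm (t - c)) * indicator (cball c \<rho>) t) \<in> borel_measurable lborel"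
  by measurable

text \<open>The data of a single row, with \<open>C\<close> and \<open>K\<close> frozen. The
  conditional bound is stated as a product with the marginal, so that marginals equal to 0 or
  infinity need no separate treatment.\<close>

locale bounded_conditional_density =
  fixes I :: "nat set" and \<nu> :: "(nat \<Rightarrow> complex) \<Rightarrow> ennreal" and C K :: real
  assumes finite_index: "finite I"
    and measurable_density [measurable]: "\<nu> \<in> borel_measurable (PiM I (\<lambda>_. lborel))"
    and total_mass: "(\<integral>\<^sup>+ w. \<nu> w \<partial>PiM I (\<lambda>_. lborel)) = 1"
    and log_moment: "\<And>j. j \<in> I \<Longrightarrow>
      (\<integral>\<^sup>+ w. \<nu> w * ennreal (log_plus (norm (w j))) \<partial>PiM I (\<lambda>_. lborel)) \<le> ennreal C"
    and conditional_bound: "\<And>j w x. j \<in> I \<Longrightarrow> w \<in> (I - {j}) \<rightarrow>\<^sub>E UNIV \<Longrightarrow>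
      \<nu> (w(j := x)) \<le> ennreal K * (\<integral>\<^sup>+ t. \<nu> (w(j := t)) \<partial>lborel)"
    and C_nonneg: "0 \<le> C" and K_nonneg: "0 \<le> K"
begin

abbreviation "\<Pi>L \<equiv> PiM I (\<lambda>_. lborel :: complex measure)"

lemma coordinate_measurable [measurable]:
  "j \<in> I \<Longrightarrow> (\<lambda>w. w j) \<in> borel_measurable \<Pi>L"
  using measurable_component_singleton[of j "I" "\<lambda>_. lborel :: complex measure"] by simp

text \<open>Fubini with coordinate \<open>j\<close> innermost: the other coordinates are frozen,
  which is where the conditional bound applies.\<close>

lemma nn_integral_coordinate:
  assumes j: "j \<in> I" and [measurable]: "f \<in> borel_measurable \<Pi>L"
  shows "(\<integral>\<^sup>+ w. f w \<partial>\<Pi>L) = (\<integral>\<^sup>+ w. \<integral>\<^sup>+ t. f (w(j := t)) \<partial>lborel \<partial>PiM (I - {j}) (\<lambda>_. lborel))"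
proof -
  interpret product_sigma_finite "\<lambda>_::nat. lborel :: complex measure" ..
  have "insert j (I - {j}) = I" using j by auto
  then show ?thesis
    using product_nn_integral_insert[of "I - {j}" j f] assms(2) finite_index by simp
qed

text \<open>For frozen other coordinates \<open>v\<close> is a constant, and the density in
  \<open>w j\<close> is at most \<open>K\<close> times the marginal. The kernel integral contributes
  \<open>4 * pi\<close> times \<rho> squared, and the marginal has total mass 1.\<close>

lemma expectation_inverse_distance:
  assumes j: "j \<in> I" and v [measurable]: "v \<in> borel_measurable \<Pi>L"
    and v_indep: "\<And>w t. v (w(j := t)) = v w" and \<rho>: "0 < \<rho>"
  shows "(\<integral>\<^sup>+ w. \<nu> w * (ennreal (\<rho> / norm (v w - w j)) * indicator (cball (v w) \<rho>) (w j)) \<partial>\<Pi>L)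
     \<le> ennreal (K * (4 * pi * \<rho>\<^sup>2))"
proof -
  have m [measurable]: "(\<lambda>w. ennreal (\<rho> / norm (v w - w j)) * indicator (cball (v w) \<rho>) (w j)) \<in> borel_measurable \<Pi>L"
    unfolding indicator_def mem_cball dist_norm using j by measurable
  let ?L = "PiM (I - {j}) (\<lambda>_. lborel :: complex measure)"
  have "(\<integral>\<^sup>+ w. \<nu> w * (ennreal (\<rho> / norm (v w - w j)) * indicator (cball (v w) \<rho>) (w j)) \<partial>\<Pi>L)
    = (\<integral>\<^sup>+ w. \<integral>\<^sup>+ t. \<nu> (w(j := t)) * (ennreal (\<rho> / norm (v w - t)) * indicator (cball (v w) \<rho>) t) \<partial>lborel \<partial>?L)"
    using j by (subst nn_integral_coordinate) (auto simp: v_indep)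
  also have "\<dots> \<le> (\<integral>\<^sup>+ w. ennreal (K * (4 * pi * \<rho>\<^sup>2)) * (\<integral>\<^sup>+ t. \<nu> (w(j := t)) \<partial>lborel) \<partial>?L)"
  proof (intro nn_integral_mono)
    fix w assume "w \<in> space ?L"
    then have w: "w \<in> (I - {j}) \<rightarrow>\<^sub>E UNIV" by (simp add: space_PiM)
    let ?c = "ennreal K * (\<integral>\<^sup>+ t. \<nu> (w(j := t)) \<partial>lborel)"
    have "(\<integral>\<^sup>+ t. \<nu> (w(j := t)) * (ennreal (\<rho> / norm (v w - t)) * indicator (cball (v w) \<rho>) t) \<partial>lborel)
      \<le> (\<integral>\<^sup>+ t. ?c * (ennreal (\<rho> / norm (t - v w)) * indicator (cball (v w) \<rho>) t) \<partial>lborel)"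
      using conditional_bound[OF j w] by (intro nn_integral_mono mult_mono) (auto simp: norm_minus_commute)
    also have "\<dots> = ?c * (\<integral>\<^sup>+ t. ennreal (\<rho> / norm (t - v w)) * indicator (cball (v w) \<rho>) t \<partial>lborel)"
      by (intro nn_integral_cmult inverse_norm_measurable)
    also have "\<dots> \<le> ?c * ennreal (4 * pi * \<rho>\<^sup>2)"
      by (intro mult_left_mono nn_integral_inverse_norm_le \<rho>) auto
    also have "\<dots> = ennreal (K * (4 * pi * \<rho>\<^sup>2)) * (\<integral>\<^sup>+ t. \<nu> (w(j := t)) \<partial>lborel)"
      using K_nonneg by (simp add: ennreal_mult mult_ac)
    finally show "(\<integral>\<^sup>+ t. \<nu> (w(j := t)) * (ennreal (\<rho> / norm (v w - t)) * indicator (cball (v w) \<rho>) t) \<partial>lborel)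
       \<le> ennreal (K * (4 * pi * \<rho>\<^sup>2)) * (\<integral>\<^sup>+ t. \<nu> (w(j := t)) \<partial>lborel)" .
  qed
  also have "\<dots> = ennreal (K * (4 * pi * \<rho>\<^sup>2)) * (\<integral>\<^sup>+ w. \<nu> w \<partial>\<Pi>L)"
  proof -
    have "(\<lambda>y. (fst y)(j := snd y)) \<in> ?L \<Otimes>\<^sub>M lborel \<rightarrow>\<^sub>M \<Pi>L"
      using j measurable_add_dim[of j "I - {j}" "\<lambda>_. lborel :: complex measure"]
      by (simp add: case_prod_beta' insert_absorb)
    then have "(\<lambda>y. \<nu> ((fst y)(j := snd y))) \<in> borel_measurable (?L \<Otimes>\<^sub>M lborel)"
      by (rule measurable_compose) measurable
    then have "(\<lambda>w. \<integral>\<^sup>+ t. \<nu> (w(j := t)) \<partial>lborel) \<in> borel_measurable ?L"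
      using lborel.borel_measurable_nn_integral_fst by (auto simp: case_prod_beta')
    then show ?thesis
      by (subst nn_integral_cmult) (auto simp: nn_integral_coordinate[OF j])
  qed
  finally show ?thesis by (simp add: total_mass)
qed

text \<open>The cost of one random factor at a fixed point \<open>x\<close>. The bound is uniform
  over the disc and over all shifts \<open>v\<close> that ignore coordinate \<open>j\<close>, so
  nothing about the remaining polynomial enters.\<close>

lemma expectation_step:
  assumes j: "j \<in> I" and v [measurable]: "v \<in> borel_measurable \<Pi>L"
    and v_indep: "\<And>w t. v (w(j := t)) = v w" and s: "0 \<le> s" and x: "norm x \<le> R"
  shows "(\<integral>\<^sup>+ w. \<nu> w * ennreal (2 * log_plus (norm (x - w j)) + ln 2 + log_minus (norm (x - w j + v w))) \<partial>\<Pi>L)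
     \<le> ennreal (2 * log_plus R + 3 * ln 2 + s + 2 * C + K * (4 * pi * (exp (- s))\<^sup>2))"
proof -
  define h where "h = (\<lambda>w. ennreal (exp (- s) / norm ((x + v w) - w j)) * indicator (cball (x + v w) (exp (- s))) (w j))"
  \<comment> \<open>Of the three copies of \<open>ln 2\<close>, two come from doubling
    \<open>log_plus_diff_le\<close> and one is already in the integrand; \<open>s\<close> pays for
    the truncation.\<close>
  define c where "c = 2 * log_plus R + 3 * ln 2 + s"
  have c: "0 \<le> c" using s log_plus_nonneg[of R] by (simp add: c_def)
  have [measurable]: "h \<in> borel_measurable \<Pi>L"
    unfolding h_def indicator_def mem_cball dist_norm using j by measurable
  have pt: "ennreal (2 * log_plus (norm (x - w j)) + ln 2 + log_minus (norm (x - w j + v w)))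
      \<le> ennreal c + ennreal 2 * ennreal (log_plus (norm (w j))) + h w" for w
  proof -
    let ?y = "norm ((x + v w) - w j)"
    let ?e = "if ?y \<le> exp (- s) then exp (- s) / ?y else 0"
    have "log_plus (norm x) \<le> log_plus R" using x by (intro log_plus_mono) auto
    moreover have "log_minus (norm (x - w j + v w)) \<le> s + ?e"
      using log_minus_truncate[OF _ s, of ?y] by (simp add: algebra_simps)
    ultimately have "2 * log_plus (norm (x - w j)) + ln 2 + log_minus (norm (x - w j + v w))
      \<le> c + 2 * log_plus (norm (w j)) + ?e"
      using log_plus_diff_le[of x "w j"] unfolding c_def by linarith
    then have "ennreal (2 * log_plus (norm (x - w j)) + ln 2 + log_minus (norm (x - w j + v w)))
      \<le> ennreal (c + 2 * log_plus (norm (w j)) + ?e)" by (rule ennreal_leI)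
    also have "\<dots> = ennreal c + ennreal 2 * ennreal (log_plus (norm (w j))) + ennreal ?e"
      using c log_plus_nonneg by (subst ennreal_plus ennreal_mult; simp)+
    also have "ennreal ?e = h w"
      by (auto simp: h_def dist_norm)
    finally show ?thesis .
  qed
  have "(\<integral>\<^sup>+ w. \<nu> w * ennreal (2 * log_plus (norm (x - w j)) + ln 2 + log_minus (norm (x - w j + v w))) \<partial>\<Pi>L)
    \<le> (\<integral>\<^sup>+ w. ennreal c * \<nu> w + ennreal 2 * (\<nu> w * ennreal (log_plus (norm (w j)))) + \<nu> w * h w \<partial>\<Pi>L)"
  proof (intro nn_integral_mono)
    fix w
    have "\<nu> w * ennreal (2 * log_plus (norm (x - w j)) + ln 2 + log_minus (norm (x - w j + v w)))
      \<le> \<nu> w * (ennreal c + ennreal 2 * ennreal (log_plus (norm (w j))) + h w)"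
      by (intro mult_left_mono pt) auto
    then show "\<nu> w * ennreal (2 * log_plus (norm (x - w j)) + ln 2 + log_minus (norm (x - w j + v w)))
      \<le> ennreal c * \<nu> w + ennreal 2 * (\<nu> w * ennreal (log_plus (norm (w j)))) + \<nu> w * h w"
      by (simp add: distrib_left mult_ac)
  qed
  also have "\<dots> = ennreal c * (\<integral>\<^sup>+ w. \<nu> w \<partial>\<Pi>L)
      + ennreal 2 * (\<integral>\<^sup>+ w. \<nu> w * ennreal (log_plus (norm (w j))) \<partial>\<Pi>L) + (\<integral>\<^sup>+ w. \<nu> w * h w \<partial>\<Pi>L)"
    using j by (simp add: nn_integral_add nn_integral_cmult)
  also have "\<dots> \<le> ennreal c * 1 + ennreal 2 * ennreal C + ennreal (K * (4 * pi * (exp (- s))\<^sup>2))"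
    unfolding h_def total_mass
    by (intro add_mono mult_left_mono log_moment[OF j] order.refl
        expectation_inverse_distance[OF j, of "\<lambda>w. x + v w" "exp (- s)"]) (auto simp: v_indep)
  also have "\<dots> = ennreal (c + 2 * C + K * (4 * pi * (exp (- s))\<^sup>2))"
    using c C_nonneg K_nonneg by (subst ennreal_plus ennreal_mult; simp)+
  finally show ?thesis by (simp add: c_def)
qed

text \<open>The one-factor inequality is summed over \<open>l\<close> stages. Each stage costs the
  bound of \<open>expectation_step\<close> at every point of the disc, hence that bound times the
  area.\<close>

lemma expectation_log_minus_quotient:
  fixes z :: "nat \<Rightarrow> complex" and n l k :: nat
  assumes I: "{1..k} \<subseteq> I" and l: "l \<le> k" and s: "0 \<le> s" and R: "0 \<le> R"
  defines "Q \<equiv> \<lambda>w j m x. poly ((pderiv ^^ m) (perturbed_poly n j z w)) x"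
  shows "(\<integral>\<^sup>+ w. \<nu> w * (\<integral>\<^sup>+ x. ennreal (log_minus (norm (Q w k l x / Q w k 0 x))) * indicator (cball 0 R) x \<partial>lborel) \<partial>\<Pi>L)
     \<le> ennreal (real l * (pi * R\<^sup>2 * (2 * log_plus R + 3 * ln 2 + s + 2 * C + K * (4 * pi * (exp (- s))\<^sup>2))))"
proof -
  let ?D = "cball (0::complex) R"
  let ?E = "2 * log_plus R + 3 * ln 2 + s + 2 * C + K * (4 * pi * (exp (- s))\<^sup>2)"
  \<comment> \<open>Stage \<open>m\<close> has \<open>J m\<close> random factors and
    \<open>m\<close> derivatives. It starts at \<open>k - l\<close> factors with no derivative,
    where the quotient is 1, and ends at \<open>k\<close> factors with \<open>l\<close>
    derivatives.\<close>
  define J where "J = (\<lambda>m. k - l + m)"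
  define v where "v = (\<lambda>m x w. of_nat (Suc m) * Q w (J m) m x / Q w (J m) (Suc m) x)"
  define T where "T = (\<lambda>m x w. 2 * log_plus (norm (x - w (Suc (J m)))) + ln 2
     + log_minus (norm (x - w (Suc (J m)) + v m x w)))"
  have J: "Suc (J m) \<in> I" "J m \<le> k" "{1..J m} \<subseteq> I" if "m < l" for m
  proof -
    have "Suc (J m) \<le> k" using that l by (simp add: J_def)
    then have "Suc (J m) \<in> {1..k}" "{1..J m} \<subseteq> {1..k}" by auto
    then show "Suc (J m) \<in> I" "J m \<le> k" "{1..J m} \<subseteq> I" using I by auto
  qed
  have T0: "0 \<le> T m x w" for m x w by (auto simp: T_def log_plus_nonneg add_nonneg_nonneg)
  have mQ: "(\<lambda>y. Q (fst y) j m (snd y)) \<in> borel_measurable (\<Pi>L \<Otimes>\<^sub>M lborel)" if "{1..j} \<subseteq> I" for j m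
    unfolding Q_def by (rule poly_perturbed_poly_measurable[OF that])
  have mv: "(\<lambda>y. v m (snd y) (fst y)) \<in> borel_measurable (\<Pi>L \<Otimes>\<^sub>M lborel)" if "m < l" for m
    unfolding v_def using mQ[OF J(3)[OF that]] by measurable
  have mw: "(\<lambda>y. fst y j) \<in> borel_measurable (\<Pi>L \<Otimes>\<^sub>M (lborel :: complex measure))" if "j \<in> I" for j
    using coordinate_measurable[OF that] by (rule measurable_compose[OF measurable_fst])
  have mT: "(\<lambda>y. T m (snd y) (fst y)) \<in> borel_measurable (\<Pi>L \<Otimes>\<^sub>M lborel)" if "m < l" for m
    unfolding T_def using mv[OF that] mw[OF J(1)[OF that]] by measurable
  have mT': "T m x \<in> borel_measurable \<Pi>L" "v m x \<in> borel_measurable \<Pi>L" if "m < l" for m x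
    using measurable_compose[OF measurable_Pair2' mT[OF that], of x]
      measurable_compose[OF measurable_Pair2' mv[OF that], of x] by simp_all
  have mH: "(\<lambda>y. \<nu> (fst y) * (ennreal (T m (snd y) (fst y)) * indicator ?D (snd y))) \<in> borel_measurable (\<Pi>L \<Otimes>\<^sub>M lborel)"
    if "m < l" for m
  proof -
    have [measurable]: "(\<lambda>y. \<nu> (fst y)) \<in> borel_measurable (\<Pi>L \<Otimes>\<^sub>M (lborel :: complex measure))"
      by (rule measurable_compose[OF measurable_fst measurable_density])
    have [measurable]: "(\<lambda>y. indicator ?D (snd y) :: ennreal) \<in> borel_measurable (\<Pi>L \<Otimes>\<^sub>M lborel)"
      by (rule measurable_compose[OF measurable_snd]) simp
    show ?thesis using mT[OF that] by measurable
  qed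
  have mTD: "(\<lambda>x. ennreal (T m x w) * indicator ?D x) \<in> borel_measurable lborel"
    if "m < l" "w \<in> space \<Pi>L" for m w
  proof -
    have "(\<lambda>x. T m x w) \<in> borel_measurable lborel"
      using measurable_compose[OF measurable_Pair1'[OF that(2)] mT[OF that(1)]] by simp
    then show ?thesis
      by (intro borel_measurable_times_ennreal measurable_compose[OF _ measurable_ennreal]) auto
  qed
  have pt: "log_minus (norm (Q w k l x / Q w k 0 x)) \<le> (\<Sum>m<l. T m x w)"
    if nz: "Q w k 0 x \<noteq> 0" "\<And>m. m < l \<Longrightarrow> Q w (J m) m x \<noteq> 0" for w x
  proof -
    have fac: "Q w j 0 x = (\<Prod>i=1..n. x - z i) * (\<Prod>i=1..j. x - w i)" for j
      by (simp add: Q_def perturbed_poly_def poly_prod)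
    have ne: "Q w j 0 x \<noteq> 0" "j < k \<Longrightarrow> x \<noteq> w (Suc j)" if "j \<le> k" for j
      using nz(1) that unfolding fac by (auto simp: Suc_le_eq)
    have "log_minus (norm (Q w (J i) i x / Q w (J i) 0 x)) \<le> (\<Sum>m<i. T m x w)" if "i \<le> l" for i
      using that
    proof (induction i)
      case 0
      then show ?case by (cases "Q w (J 0) 0 x = 0") auto
    next
      case (Suc i)
      have Js: "J (Suc i) = Suc (J i)" by (simp add: J_def)
      have Jk: "J i < k" using Suc.prems l by (simp add: J_def)
      have "log_minus (norm (Q w (J (Suc i)) (Suc i) x / Q w (J (Suc i)) 0 x))
         \<le> log_minus (norm (Q w (J i) i x / Q w (J i) 0 x)) + T i x w"
        unfolding T_def v_def Js Q_def
        by (rule log_minus_deriv_quotient_step) (use ne[of "J i"] Jk nz(2)[of i] Suc.prems in \<open>auto simp: Q_def\<close>)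
      also have "\<dots> \<le> (\<Sum>m<Suc i. T m x w)" using Suc by simp
      finally show ?case .
    qed
    from this[of l] show ?thesis using l by (simp add: J_def)
  qed
  \<comment> \<open>The exceptional points may depend on \<open>w\<close>, since the inner integral
    is taken for fixed \<open>w\<close>. The derivatives are nonzero polynomials because
    \<open>m\<close> does not exceed the degree \<open>n + J m\<close>.\<close>
  have ae: "AE x in lborel. Q w k 0 x \<noteq> 0 \<and> (\<forall>m\<in>{..<l}. Q w (J m) m x \<noteq> 0)" for w
  proof (intro AE_conjI)
    show "AE x in lborel. Q w k 0 x \<noteq> 0"
      unfolding Q_def by (rule AE_poly_nonzero) (simp add: perturbed_poly_nonzero)
    show "AE x in lborel. \<forall>m\<in>{..<l}. Q w (J m) m x \<noteq> 0"
    proof (subst AE_finite_all)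
      show "\<forall>m\<in>{..<l}. AE x in lborel. Q w (J m) m x \<noteq> 0"
        unfolding Q_def
        by (intro ballI AE_poly_nonzero pderiv_funpow_nonzero(1) perturbed_poly_nonzero)
          (use l in \<open>auto simp: degree_perturbed_poly J_def\<close>)
    qed simp
  qed
  have "(\<integral>\<^sup>+ w. \<nu> w * (\<integral>\<^sup>+ x. ennreal (log_minus (norm (Q w k l x / Q w k 0 x))) * indicator ?D x \<partial>lborel) \<partial>\<Pi>L)
    \<le> (\<integral>\<^sup>+ w. \<nu> w * (\<Sum>m<l. \<integral>\<^sup>+ x. ennreal (T m x w) * indicator ?D x \<partial>lborel) \<partial>\<Pi>L)"
  proof (intro nn_integral_mono mult_left_mono)
    fix w assume w: "w \<in> space \<Pi>L"
    have "(\<integral>\<^sup>+ x. ennreal (log_minus (norm (Q w k l x / Q w k 0 x))) * indicator ?D x \<partial>lborel)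
      \<le> (\<integral>\<^sup>+ x. (\<Sum>m<l. ennreal (T m x w) * indicator ?D x) \<partial>lborel)"
    proof (intro nn_integral_mono_AE, use ae[of w] in eventually_elim)
      case (elim x)
      then have "ennreal (log_minus (norm (Q w k l x / Q w k 0 x))) \<le> ennreal (\<Sum>m<l. T m x w)"
        by (intro ennreal_leI pt) auto
      also have "\<dots> = (\<Sum>m<l. ennreal (T m x w))" using T0 by (intro sum_ennreal[symmetric])
      finally show ?case by (simp add: sum_distrib_right[symmetric] mult_right_mono)
    qed
    also have "\<dots> = (\<Sum>m<l. \<integral>\<^sup>+ x. ennreal (T m x w) * indicator ?D x \<partial>lborel)"
      using w by (intro nn_integral_sum mTD) auto
    finally show "(\<integral>\<^sup>+ x. ennreal (log_minus (norm (Q w k l x / Q w k 0 x))) * indicator ?D x \<partial>lborel)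
      \<le> (\<Sum>m<l. \<integral>\<^sup>+ x. ennreal (T m x w) * indicator ?D x \<partial>lborel)" .
  qed simp
  also have "\<dots> = (\<Sum>m<l. \<integral>\<^sup>+ w. \<integral>\<^sup>+ x. \<nu> w * (ennreal (T m x w) * indicator ?D x) \<partial>lborel \<partial>\<Pi>L)"
  proof -
    have "(\<integral>\<^sup>+ w. \<nu> w * (\<Sum>m<l. \<integral>\<^sup>+ x. ennreal (T m x w) * indicator ?D x \<partial>lborel) \<partial>\<Pi>L)
       = (\<integral>\<^sup>+ w. (\<Sum>m<l. \<integral>\<^sup>+ x. \<nu> w * (ennreal (T m x w) * indicator ?D x) \<partial>lborel) \<partial>\<Pi>L)"
      by (intro nn_integral_cong) (auto simp: sum_distrib_left intro!: sum.cong nn_integral_cmult[symmetric] mTD)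
    also have "\<dots> = (\<Sum>m<l. \<integral>\<^sup>+ w. \<integral>\<^sup>+ x. \<nu> w * (ennreal (T m x w) * indicator ?D x) \<partial>lborel \<partial>\<Pi>L)"
    proof (rule nn_integral_sum)
      fix m assume "m \<in> {..<l}"
      then show "(\<lambda>w. \<integral>\<^sup>+ x. \<nu> w * (ennreal (T m x w) * indicator ?D x) \<partial>lborel) \<in> borel_measurable \<Pi>L"
        using lborel.borel_measurable_nn_integral_fst[OF mH[of m]] by simp
    qed
    finally show ?thesis .
  qed
  also have "\<dots> \<le> (\<Sum>m<l. ennreal (pi * R\<^sup>2 * ?E))"
  proof (rule sum_mono)
    fix m assume "m \<in> {..<l}"
    then have m: "m < l" by simp
    interpret product_sigma_finite "\<lambda>_::nat. lborel :: complex measure" ..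
    interpret P: pair_sigma_finite \<Pi>L "lborel :: complex measure"
      using sigma_finite[OF finite_index] by (intro pair_sigma_finite.intro) (auto intro: lborel.sigma_finite_measure_axioms)
    \<comment> \<open>The shift depends on \<open>x\<close>, so the expectation must be taken first,
      at fixed \<open>x\<close>.\<close>
    have "(\<integral>\<^sup>+ w. \<integral>\<^sup>+ x. \<nu> w * (ennreal (T m x w) * indicator ?D x) \<partial>lborel \<partial>\<Pi>L)
       = (\<integral>\<^sup>+ x. \<integral>\<^sup>+ w. \<nu> w * (ennreal (T m x w) * indicator ?D x) \<partial>\<Pi>L \<partial>lborel)"
      using P.Fubini'[of "\<lambda>w x. \<nu> w * (ennreal (T m x w) * indicator ?D x)"] mH[OF m]
      by (simp add: case_prod_beta')
    also have "\<dots> \<le> (\<integral>\<^sup>+ x. ennreal ?E * indicator ?D x \<partial>lborel)"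
    proof (rule nn_integral_mono)
      fix x
      show "(\<integral>\<^sup>+ w. \<nu> w * (ennreal (T m x w) * indicator ?D x) \<partial>\<Pi>L) \<le> ennreal ?E * indicator ?D x"
      proof (cases "x \<in> ?D")
        case True
        have indep: "v m x (w(Suc (J m) := t)) = v m x w" for w t
        proof -
          have "perturbed_poly n (J m) z (w(Suc (J m) := t)) = perturbed_poly n (J m) z w"
            by (rule perturbed_poly_cong) auto
          then show ?thesis by (simp add: v_def Q_def)
        qed
        have "(\<integral>\<^sup>+ w. \<nu> w * ennreal (T m x w) \<partial>\<Pi>L) \<le> ennreal ?E"
          unfolding T_def using True
          by (intro expectation_step J(1) mT'(2) m indep s) auto
        then show ?thesis using True by simp
      qed simp
    qed
    also have "\<dots> = ennreal ?E * ennreal (pi * R\<^sup>2)"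
      using R by (subst nn_integral_cmult_indicator) (simp_all only: emeasure_cball_complex, auto)
    also have "\<dots> = ennreal (pi * R\<^sup>2) * ennreal ?E"
      by (rule mult.commute)
    also have "\<dots> = ennreal (pi * R\<^sup>2 * ?E)"
      by (rule ennreal_mult'[symmetric]) simp
    finally show "(\<integral>\<^sup>+ w. \<integral>\<^sup>+ x. \<nu> w * (ennreal (T m x w) * indicator ?D x) \<partial>lborel \<partial>\<Pi>L) \<le> ennreal (pi * R\<^sup>2 * ?E)" .
  qed
  also have "\<dots> = ennreal (real l * (pi * R\<^sup>2 * ?E))"
    by (simp add: ennreal_mult' ennreal_of_nat_eq_real_of_nat)
  finally show ?thesis .
qed

end

subsection \<open>Jensen's formula and smoothed sums over zeros\<close>


text \<open>Mean value property: for \<open>norm t < 1\<close> the values 1 - t z stay in the right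
  half-plane, so \<open>Ln (1 - t * z)\<close> is holomorphic on the closed disc. Cauchy's formula
  at the centre gives \<open>Ln 1 = 0\<close>; the real part is the claim.\<close>

lemma has_integral_ln_norm_circle:
  fixes t :: complex
  assumes "norm t < 1"
  shows "((\<lambda>x. ln (norm (1 - t * circlepath 0 1 x))) has_integral 0) {0..1}"
proof -
  have pos: "0 < Re (1 - t * z)" if "norm z \<le> 1" for z
  proof -
    have "norm (t * z) \<le> norm t * 1" unfolding norm_mult by (intro mult_left_mono that) auto
    then have "Re (t * z) < 1" using assms complex_Re_le_cmod[of "t * z"] by linarith
    then show ?thesis by simp
  qed
  then have nz: "1 - t * z \<notin> \<real>\<^sub>\<le>\<^sub>0" if "norm z \<le> 1" for z
    using that by (metis complex_nonpos_Reals_iff not_le)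
  have hol: "(\<lambda>z. Ln (1 - t * z)) holomorphic_on cball 0 1"
    using nz by (intro holomorphic_intros) auto
  have "((\<lambda>u. Ln (1 - t * u) / (u - 0)) has_contour_integral (2 * of_real pi * \<i> * Ln (1 - t * 0))) (circlepath 0 1)"
    using hol holomorphic_on_subset[OF hol ball_subset_cball]
    by (intro Cauchy_integral_circlepath holomorphic_on_imp_continuous_on) auto
  then have "((\<lambda>x. Ln (1 - t * circlepath 0 1 x) / circlepath 0 1 x
      * vector_derivative (circlepath 0 1) (at x within {0..1})) has_integral 0) {0..1}"
    by (simp add: has_contour_integral_def)
  then have "((\<lambda>x. 2 * of_real pi * \<i> * Ln (1 - t * circlepath 0 1 x)) has_integral 0) {0..1}"
    by (rule has_integral_eq[rotated]) (simp add: vector_derivative_circlepath01, simp add: circlepath)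
  from has_integral_mult_right[OF this, of "1 / (2 * of_real pi * \<i>)"]
  have "((\<lambda>x. Ln (1 - t * circlepath 0 1 x)) has_integral 0) {0..1}"
    by simp
  from has_integral_Re[OF this] have "((\<lambda>x. Re (Ln (1 - t * circlepath 0 1 x))) has_integral 0) {0..1}"
    by simp
  moreover have "Re (Ln (1 - t * circlepath 0 1 x)) = ln (norm (1 - t * circlepath 0 1 x))" for x
  proof -
    have "norm (circlepath 0 1 x) \<le> 1" by (simp add: circlepath)
    from pos[OF this] have "1 - t * circlepath 0 1 x \<noteq> 0" by (metis less_irrefl zero_complex.sel(1))
    then show ?thesis by simp
  qed
  ultimately show ?thesis by simp
qed

text \<open>Factoring out the larger of \<open>r\<close> and \<open>norm (u - c)\<close> leaves 1 -
  t e with |t| < 1, whose logarithm averages to 0.\<close>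

lemma has_integral_ln_norm_diff_circle:
  fixes c u :: complex
  assumes r: "0 < r" and u: "norm (u - c) \<noteq> r"
  shows "((\<lambda>x. ln (norm (circlepath c r x - u))) has_integral ln (max r (norm (u - c)))) {0..1}"
proof -
  define e where "e = circlepath 0 1"
  have ne: "norm (e x) = 1" for x by (simp add: e_def circlepath)
  have ce: "circlepath c r x = c + of_real r * e x" for x by (simp add: e_def circlepath)
  obtain q t where q: "q = max r (norm (u - c))" "0 < q" and t: "norm t < 1"
    and eq: "\<And>x. norm (circlepath c r x - u) = q * norm (1 - t * e x)"
  proof (cases "norm (u - c) < r")
    case True
    \<comment> \<open>For \<open>u\<close> inside the circle the unit factor \<open>e x\<close> is
      pulled out instead; conjugation then restores the form 1 - t e, with
      \<open>t = cnj s\<close>.\<close>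
    define s where "s = (u - c) / of_real r"
    have "norm (circlepath c r x - u) = r * norm (1 - cnj s * e x)" for x
    proof -
      have "e x * cnj (e x) = 1"
        using complex_norm_square[of "e x"] ne[of x] by simp
      then have "circlepath c r x - u = of_real r * e x - of_real r * s * (e x * cnj (e x))"
        using r by (simp add: ce s_def)
      also have "\<dots> = of_real r * e x * (1 - s * cnj (e x))"
        by (simp add: algebra_simps)
      finally have "circlepath c r x - u = of_real r * e x * (1 - s * cnj (e x))" .
      then have "norm (circlepath c r x - u) = r * norm (1 - s * cnj (e x))"
        using r ne by (simp add: norm_mult)
      also have "norm (1 - s * cnj (e x)) = norm (cnj (1 - s * cnj (e x)))"
        by (rule complex_mod_cnj[symmetric])
      finally show ?thesis by simp
    qed
    moreover have "norm (cnj s) < 1" using True r unfolding complex_mod_cnj by (simp add: s_def norm_divide)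
    ultimately show ?thesis using that[of r "cnj s"] True r by simp
  next
    case False
    then have F: "r < norm (u - c)" using u by simp
    define s where "s = of_real r / (u - c)"
    have n: "u - c \<noteq> 0" using F r by auto
    have "norm (circlepath c r x - u) = norm (u - c) * norm (1 - s * e x)" for x
    proof -
      have "circlepath c r x - u = - ((u - c) * (1 - s * e x))"
        using n by (simp add: ce s_def right_diff_distrib)
      then show ?thesis by (simp only: norm_minus_cancel norm_mult)
    qed
    moreover have "norm s < 1" using F r by (simp add: s_def norm_divide divide_less_eq)
    ultimately show ?thesis using that[of "norm (u - c)" s] F r n by simp
  qed
  have nz: "norm (1 - t * e x) \<noteq> 0" for x
  proof
    assume "norm (1 - t * e x) = 0"
    then have "norm (t * e x) = 1" by (metis norm_eq_zero norm_one right_minus_eq)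
    then show False using t ne by (simp add: norm_mult)
  qed
  have "((\<lambda>x. ln q + ln (norm (1 - t * e x))) has_integral (ln q + 0)) {0..1}"
    using has_integral_const_real[of "ln q" 0 1] has_integral_ln_norm_circle[OF t]
    unfolding e_def by (intro has_integral_add) auto
  moreover have "ln q + ln (norm (1 - t * e x)) = ln (norm (circlepath c r x - u))" for x
    unfolding eq using q nz[of x] by (simp add: ln_mult)
  ultimately show ?thesis using q by simp
qed

text \<open>Jensen's formula, obtained by adding the one-zero case over the linear factors.\<close>

lemma has_integral_ln_norm_poly_circle:
  fixes p :: "complex poly"
  assumes p: "p \<noteq> 0" and r: "0 < r" and roots: "\<And>w. poly p w = 0 \<Longrightarrow> norm (w - c) \<noteq> r"
  shows "((\<lambda>x. ln (norm (poly p (circlepath c r x)))) has_integral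
     ln (norm (lead_coeff p)) + (\<Sum>w\<in>#proots p. ln (max r (norm (w - c))))) {0..1}"
proof -
  have *: "((\<lambda>x. ln (norm (poly (smult b (\<Prod>w\<in>#A. [:- w, 1:])) (circlepath c r x)))) has_integral
     ln (norm b) + (\<Sum>w\<in>#A. ln (max r (norm (w - c))))) {0..1}"
    if "b \<noteq> 0" "\<And>w. w \<in># A \<Longrightarrow> norm (w - c) \<noteq> r" for b A
    using that(2)
  proof (induction A)
    case empty
    then show ?case using has_integral_const_real[of "ln (norm b)" 0 1] by simp
  next
    case (add a A)
    let ?p = "smult b (\<Prod>w\<in>#A. [:- w, 1:])"
    have "((\<lambda>x. ln (norm (circlepath c r x - a)) + ln (norm (poly ?p (circlepath c r x)))) has_integral
      ln (max r (norm (a - c))) + (ln (norm b) + (\<Sum>w\<in>#A. ln (max r (norm (w - c)))))) {0..1}"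
      using add by (intro has_integral_add has_integral_ln_norm_diff_circle r) auto
    moreover have "ln (norm (circlepath c r x - a)) + ln (norm (poly ?p (circlepath c r x)))
       = ln (norm (poly (smult b (\<Prod>w\<in>#add_mset a A. [:- w, 1:])) (circlepath c r x)))" for x
    proof -
      have s: "circlepath c r x \<noteq> w" if "w \<in># add_mset a A" for w
        using add.prems[OF that] r by (auto simp: circlepath norm_mult)
      then have "circlepath c r x - a \<noteq> 0" "poly ?p (circlepath c r x) \<noteq> 0"
        using \<open>b \<noteq> 0\<close> by (auto simp: poly_prod_mset prod_mset_zero_iff)
      moreover have "poly (smult b (\<Prod>w\<in>#add_mset a A. [:- w, 1:])) y = (y - a) * poly ?p y" for y
        by (simp add: algebra_simps)
      ultimately show ?thesis by (simp only: norm_mult ln_mult_pos zero_less_norm_iff simp_thms)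
    qed
    ultimately show ?case by (simp add: algebra_simps)
  qed
  have "norm (w - c) \<noteq> r" if "w \<in># proots p" for w
    using that p roots by simp
  moreover have "lead_coeff p \<noteq> 0" using p by simp
  ultimately show ?thesis
    using *[of "lead_coeff p" "proots p"] unfolding complex_poly_decompose_multiset by blast
qed

section \<open>The kernel produced by two concentric circles\<close>

text \<open>With \<open>u = w - c\<close>, this is the contribution of a zero \<open>w\<close> to
  the circle average at radius \<open>2 * r\<close> minus that at radius \<open>r\<close>. It is
  \<open>ln 2\<close> up to radius \<open>r\<close>, then \<open>ln (2 * r / norm u)\<close>, and 0
  from \<open>2 * r\<close> on: a test function available from Jensen's formula alone.\<close>

definition log_tent :: "real \<Rightarrow> complex \<Rightarrow> real" where
  "log_tent r u = ln (max (2 * r) (norm u)) - ln (max r (norm u))"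

lemma log_tent_bounds:
  assumes "0 < r"
  shows "0 \<le> log_tent r u" "log_tent r u \<le> ln 2"
    and "2 * r \<le> norm u \<Longrightarrow> log_tent r u = 0" and "norm u \<le> r \<Longrightarrow> log_tent r u = ln 2"
proof -
  show "0 \<le> log_tent r u" using assms by (simp add: log_tent_def)
  have "ln (max (2 * r) (norm u)) \<le> ln (2 * max r (norm u))" using assms by simp
  also have "\<dots> = ln 2 + ln (max r (norm u))" using assms by (subst ln_mult) auto
  finally show "log_tent r u \<le> ln 2" by (simp add: log_tent_def)
  show "2 * r \<le> norm u \<Longrightarrow> log_tent r u = 0" using assms by (simp add: log_tent_def)
  show "norm u \<le> r \<Longrightarrow> log_tent r u = ln 2" using assms by (simp add: log_tent_def ln_mult)
qed

lemma log_tent_commute: "log_tent r (u - v) = log_tent r (v - u)"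
  by (simp add: log_tent_def norm_minus_commute)

lemma log_tent_measurable [measurable]: "log_tent r \<in> borel_measurable borel"
  unfolding log_tent_def[abs_def] by measurable

lemma integrable_bounded_cball:
  fixes f :: "complex \<Rightarrow> real"
  assumes "f \<in> borel_measurable borel" "\<And>c. \<bar>f c\<bar> \<le> K" "\<And>c. norm c > R \<Longrightarrow> f c = 0"
  shows "integrable lborel f"
proof (rule Bochner_Integration.integrable_bound)
  have "emeasure lborel (cball 0 R :: complex set) < \<infinity>"
    by (rule emeasure_bounded_finite) simp
  then show "integrable lborel (\<lambda>c::complex. K * indicator (cball 0 R) c)"
    by (intro integrable_mult_right integrable_real_indicator) auto
  show "AE c in lborel. norm (f c) \<le> norm (K * indicator (cball 0 R) c)"
  proof (intro AE_I2)
    fix c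
    have "norm (f c) \<le> \<bar>K\<bar>" using assms(2)[of c] by simp
    then show "norm (f c) \<le> norm (K * indicator (cball 0 R) c)"
      using assms(3)[of c] by (cases "norm c > R") auto
  qed
qed (use assms in simp)

text \<open>The kernel equals \<open>ln 2\<close> on a whole disc, so its mass is positive and can
  be divided by; translation invariance makes the mass the same for every centre.\<close>

lemma log_tent_integral:
  assumes "0 < r"
  shows "integrable lborel (log_tent r)" "0 < integral\<^sup>L lborel (log_tent r)"
    and "integrable lborel (\<lambda>c. log_tent r (c - w))"
    and "(\<integral>c. log_tent r (c - w) \<partial>lborel) = integral\<^sup>L lborel (log_tent r)"
proof -
  note b = log_tent_bounds[OF assms]
  show int: "integrable lborel (log_tent r)"
    using b by (intro integrable_bounded_cball[of _ "ln 2" "2 * r"]) auto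
  have m: "measure lborel (cball 0 r :: complex set) = pi * r\<^sup>2"
    using assms by (simp add: measure_def emeasure_cball_complex)
  have "0 < ln 2 * (pi * r\<^sup>2)" using assms by simp
  also have "\<dots> = (\<integral>c. ln 2 * indicator (cball (0::complex) r) c \<partial>lborel)"
    by (simp add: m)
  also have "\<dots> \<le> integral\<^sup>L lborel (log_tent r)"
  proof (rule integral_mono[OF _ int])
    have "emeasure lborel (cball 0 r :: complex set) < \<infinity>" by (rule emeasure_bounded_finite) simp
    then show "integrable lborel (\<lambda>c::complex. (ln 2 :: real) * indicator (cball 0 r) c)"
      by (intro integrable_mult_right integrable_real_indicator) auto
  qed (use b in \<open>auto simp: indicator_def\<close>)
  finally show "0 < integral\<^sup>L lborel (log_tent r)" .
  have d: "distr lborel borel ((+) (- w)) = (lborel :: complex measure)" by (rule lborel_distr_plus)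
  have i: "integrable (distr lborel borel ((+) (- w))) (log_tent r)" unfolding d by (rule int)
  show "integrable lborel (\<lambda>c. log_tent r (c - w))"
    using i by (subst (asm) integrable_distr_eq) auto
  have "integral\<^sup>L (distr lborel borel ((+) (- w))) (log_tent r) = (\<integral>c. log_tent r (- w + c) \<partial>lborel)"
    by (subst integral_distr) auto
  then show "(\<integral>c. log_tent r (c - w) \<partial>lborel) = integral\<^sup>L lborel (log_tent r)"
    unfolding d by simp
qed

text \<open>Passes from the gauge integral of the contour argument to a nonnegative Lebesgue
  integral, to which Fubini applies without integrability conditions.\<close>

lemma abs_has_integral_le_nn_integral:
  fixes F :: "real \<Rightarrow> real"
  assumes "continuous_on {0..1} F" "(F has_integral S) {0..1}"
  shows "ennreal \<bar>S\<bar> \<le> (\<integral>\<^sup>+ x. ennreal \<bar>F x\<bar> * indicator {0..1} x \<partial>lborel)"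
proof -
  have i: "set_integrable lborel {0..1} F"
    using assms(1) by (intro borel_integrable_atLeastAtMost') auto
  have "S = (LINT x:{0..1}|lborel. F x)"
    using set_borel_integral_eq_integral(2)[OF i] assms(2) by (simp add: integral_unique)
  then have "ennreal \<bar>S\<bar> = ennreal (norm (LINT x|lborel. indicator {0..1} x *\<^sub>R F x))"
    by (simp add: set_lebesgue_integral_def)
  also have "\<dots> \<le> (\<integral>\<^sup>+ x. norm (indicator {0..1} x *\<^sub>R F x) \<partial>lborel)"
    using i unfolding set_integrable_def by (rule integral_norm_bound_ennreal)
  also have "\<dots> = (\<integral>\<^sup>+ x. ennreal \<bar>F x\<bar> * indicator {0..1} x \<partial>lborel)"
    by (intro nn_integral_cong) (auto simp: indicator_def)
  finally show ?thesis .
qed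

lemma circlepath_measurable [measurable (raw)]:
  assumes [measurable]: "f \<in> borel_measurable M" "g \<in> borel_measurable M"
  shows "(\<lambda>y. circlepath (f y) r (g y)) \<in> borel_measurable M"
proof -
  have [measurable]: "circlepath 0 r \<in> borel_measurable borel"
    unfolding circlepath by (intro borel_measurable_continuous_onI continuous_intros)
  have "circlepath (f y) r (g y) = f y + circlepath 0 r (g y)" for y by (simp add: circlepath)
  then show ?thesis by simp
qed

text \<open>Jensen's formula is used for both polynomials on both circles. The leading coefficients
  do not depend on the radius and drop out, leaving only logarithms of the quotient.\<close>

lemma log_tent_sum_bound:
  fixes P A :: "complex poly"
  assumes "P \<noteq> 0" "A \<noteq> 0" and r: "0 < r"
    and roots: "\<And>w s. poly P w = 0 \<or> poly A w = 0 \<Longrightarrow> s = r \<or> s = 2 * r \<Longrightarrow> norm (w - c) \<noteq> s"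
  defines "F \<equiv> \<lambda>z. \<bar>ln (norm (poly A z / poly P z))\<bar>"
  shows "ennreal \<bar>(\<Sum>w\<in>#proots A. log_tent r (w - c)) - (\<Sum>w\<in>#proots P. log_tent r (w - c))\<bar>
     \<le> (\<integral>\<^sup>+ x. (ennreal (F (circlepath c (2 * r) x)) + ennreal (F (circlepath c r x))) * indicator {0..1} x \<partial>lborel)"
proof -
  define G where "G = (\<lambda>s x. ln (norm (poly A (circlepath c s x))) - ln (norm (poly P (circlepath c s x))))"
  define J where "J = (\<lambda>s p. ln (norm (lead_coeff p)) + (\<Sum>w\<in>#proots p. ln (max s (norm (w - c)))))"
  have nz: "poly p (circlepath c s x) \<noteq> 0" if "s = r \<or> s = 2 * r" "p = A \<or> p = P" for p s x
  proof
    assume "poly p (circlepath c s x) = 0"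
    then have "norm (circlepath c s x - c) \<noteq> s" using roots that by blast
    then show False using that(1) r by (auto simp: circlepath norm_mult)
  qed
  have hi: "(G s has_integral (J s A - J s P)) {0..1}" if "s = r \<or> s = 2 * r" for s
    unfolding G_def J_def using assms(1,2) r roots that
    by (intro has_integral_diff has_integral_ln_norm_poly_circle) auto
  have co: "continuous_on {0..1} (G s)" if "s = r \<or> s = 2 * r" for s
    unfolding G_def using nz[OF that] unfolding circlepath by (intro continuous_intros) auto
  have FG: "F (circlepath c s x) = \<bar>G s x\<bar>" if "s = r \<or> s = 2 * r" for s x
    using nz[OF that] by (simp add: F_def G_def norm_divide ln_div)
  have "(\<Sum>w\<in>#B. log_tent r (w - c)) = (\<Sum>w\<in>#B. ln (max (2 * r) (norm (w - c)))) - (\<Sum>w\<in>#B. ln (max r (norm (w - c))))" for B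
    by (induction B) (auto simp: log_tent_def)
  then have "(\<Sum>w\<in>#proots A. log_tent r (w - c)) - (\<Sum>w\<in>#proots P. log_tent r (w - c))
      = (J (2 * r) A - J (2 * r) P) - (J r A - J r P)"
    by (simp add: J_def)
  then have "ennreal \<bar>(\<Sum>w\<in>#proots A. log_tent r (w - c)) - (\<Sum>w\<in>#proots P. log_tent r (w - c))\<bar>
     \<le> (\<integral>\<^sup>+ x. ennreal \<bar>G (2 * r) x - G r x\<bar> * indicator {0..1} x \<partial>lborel)"
    using abs_has_integral_le_nn_integral[OF _ has_integral_diff[OF hi hi], of "2 * r" r] co
    by (simp add: continuous_on_diff)
  also have "\<dots> \<le> (\<integral>\<^sup>+ x. (ennreal (F (circlepath c (2 * r) x)) + ennreal (F (circlepath c r x))) * indicator {0..1} x \<partial>lborel)"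
    by (intro nn_integral_mono mult_right_mono) (auto simp: FG intro!: ennreal_leI simp flip: ennreal_plus)
  finally show ?thesis .
qed

lemma AE_norm_diff_neq: "AE c in lborel. norm ((w :: complex) - c) \<noteq> s"
proof -
  have "AE c in lebesgue. c \<notin> sphere w s"
    using AE_not_in negligible_sphere negligible_iff_null_sets by blast
  then have "AE c in lborel. c \<notin> sphere w s"
    by (simp add: AE_completion_iff)
  then show ?thesis by (rule AE_mp) (auto simp: dist_norm)
qed

text \<open>At a fixed angle the point on the circle is the centre plus a fixed vector, so
  integrating over centres is integrating over a translated disc.\<close>

lemma nn_integral_translate_cball_le:
  fixes F :: "complex \<Rightarrow> ennreal"
  assumes [measurable]: "F \<in> borel_measurable borel" and "norm a \<le> s"
  shows "(\<integral>\<^sup>+ c. F (a + c) * indicator (cball 0 R) c \<partial>lborel) \<le> (\<integral>\<^sup>+ z. F z * indicator (cball 0 (R + s)) z \<partial>lborel)"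
proof -
  have "(\<integral>\<^sup>+ c. F (a + c) * indicator (cball 0 R) c \<partial>lborel)
     \<le> (\<integral>\<^sup>+ c. F (a + c) * indicator (cball 0 (R + s)) (a + c) \<partial>lborel)"
  proof (intro nn_integral_mono mult_left_mono)
    fix c
    have "norm (a + c) \<le> R + s" if "norm c \<le> R" using norm_triangle_ineq[of a c] assms(2) that by linarith
    then show "indicator (cball 0 R) c \<le> (indicator (cball 0 (R + s)) (a + c) :: ennreal)"
      by (auto simp: indicator_def)
  qed simp
  also have "\<dots> = (\<integral>\<^sup>+ z. F z * indicator (cball 0 (R + s)) z \<partial>distr lborel borel ((+) a))"
    by (subst nn_integral_distr) auto
  finally show ?thesis by (simp add: lborel_distr_plus)
qed

text \<open>Jensen's formula on almost every circle turns a difference of linear statistics of zeros into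
  an area integral of the logarithm of the quotient.\<close>

lemma smoothed_root_sum_bound:
  fixes P A :: "complex poly" and h :: "complex \<Rightarrow> real"
  assumes PA: "P \<noteq> 0" "A \<noteq> 0" and r: "0 < r"
    and h: "h \<in> borel_measurable borel" "\<And>c. \<bar>h c\<bar> \<le> B" "\<And>c. norm c > R \<Longrightarrow> h c = 0"
  defines "F \<equiv> \<lambda>z. \<bar>ln (norm (poly A z / poly P z))\<bar>"
    and "g \<equiv> \<lambda>w. \<integral>c. h c * log_tent r (w - c) \<partial>lborel"
  shows "ennreal \<bar>(\<Sum>w\<in>#proots A. g w) - (\<Sum>w\<in>#proots P. g w)\<bar>
     \<le> ennreal (2 * B) * (\<integral>\<^sup>+ z. ennreal (F z) * indicator (cball 0 (R + 2 * r)) z \<partial>lborel)"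
proof -
  note [measurable] = h(1)
  have [measurable]: "F \<in> borel_measurable borel" unfolding F_def by measurable
  have B: "0 \<le> B" using h(2)[of 0] by linarith
  have int: "integrable lborel (\<lambda>c. h c * log_tent r (w - c))" for w
  proof (rule integrable_bounded_cball)
    show "\<bar>h c * log_tent r (w - c)\<bar> \<le> B * ln 2" for c
      unfolding abs_mult using h(2) log_tent_bounds[OF r, of "w - c"] B by (intro mult_mono) auto
    show "h c * log_tent r (w - c) = 0" if "norm c > R" for c using h(3)[OF that] by simp
  qed measurable
  have sums: "(\<Sum>w\<in>#C. g w) = (\<integral>c. h c * (\<Sum>w\<in>#C. log_tent r (w - c)) \<partial>lborel)
     \<and> integrable lborel (\<lambda>c. h c * (\<Sum>w\<in>#C. log_tent r (w - c)))" for C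
    by (induction C) (auto simp: g_def distrib_left int)
  define D where "D = (\<lambda>c. (\<Sum>w\<in>#proots A. log_tent r (w - c)) - (\<Sum>w\<in>#proots P. log_tent r (w - c)))"
  have Dint: "integrable lborel (\<lambda>c. h c * D c)" and
    Deq: "(\<Sum>w\<in>#proots A. g w) - (\<Sum>w\<in>#proots P. g w) = (\<integral>c. h c * D c \<partial>lborel)"
    using sums[of "proots A"] sums[of "proots P"] by (auto simp: D_def right_diff_distrib)
  let ?I = "\<integral>\<^sup>+ z. ennreal (F z) * indicator (cball 0 (R + 2 * r)) z \<partial>lborel"
  let ?K = "\<lambda>c x. ennreal (F (circlepath c (2 * r) x)) + ennreal (F (circlepath c r x))"
  \<comment> \<open>Centres with a zero on one of the two circles lie on finitely many circles
    around the zeros, a null set.\<close>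
  have "finite {w. poly P w = 0 \<or> poly A w = 0}"
    using poly_roots_finite[OF PA(1)] poly_roots_finite[OF PA(2)] by (simp add: Collect_disj_eq)
  then have "AE c in lborel. \<forall>w\<in>{w. poly P w = 0 \<or> poly A w = 0}. norm (w - c) \<noteq> r \<and> norm (w - c) \<noteq> 2 * r"
    by (subst AE_finite_all) (auto intro: AE_norm_diff_neq)
  then have ae: "AE c in lborel. ennreal \<bar>D c\<bar> \<le> (\<integral>\<^sup>+ x. ?K c x * indicator {0..1} x \<partial>lborel)"
  proof eventually_elim
    case (elim c)
    then show ?case unfolding D_def F_def by (intro log_tent_sum_bound PA r) auto
  qed
  define e where "e = (\<lambda>s x. circlepath 0 s x)"
  have cp: "circlepath c s x = e s x + c" for c s x by (simp add: e_def circlepath)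
  have "ennreal \<bar>(\<Sum>w\<in>#proots A. g w) - (\<Sum>w\<in>#proots P. g w)\<bar> \<le> (\<integral>\<^sup>+ c. norm (h c * D c) \<partial>lborel)"
    unfolding Deq using integral_norm_bound_ennreal[OF Dint] by simp
  also have "\<dots> \<le> (\<integral>\<^sup>+ c. \<integral>\<^sup>+ x. ennreal B * (?K c x * indicator (cball 0 R) c) * indicator {0..1} x \<partial>lborel \<partial>lborel)"
  proof (intro nn_integral_mono_AE, use ae in eventually_elim)
    case (elim c)
    have "ennreal (norm (h c * D c)) \<le> ennreal B * indicator (cball 0 R) c * ennreal \<bar>D c\<bar>"
      using h(2)[of c] h(3)[of c] B
      by (cases "norm c > R") (auto simp: abs_mult ennreal_mult' intro!: mult_right_mono ennreal_leI)
    also have "\<dots> \<le> ennreal B * indicator (cball 0 R) c * (\<integral>\<^sup>+ x. ?K c x * indicator {0..1} x \<partial>lborel)"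
      by (intro mult_left_mono elim) auto
    also have "\<dots> = (\<integral>\<^sup>+ x. ennreal B * (?K c x * indicator (cball 0 R) c) * indicator {0..1} x \<partial>lborel)"
      by (subst nn_integral_cmult[symmetric]) (auto intro!: nn_integral_cong simp: mult_ac)
    finally show ?case .
  qed
  \<comment> \<open>Exchanging centre and angle turns each circle into a translation of length at
    most \<open>2 * r\<close>, hence the enlarged disc. Each of the two circles gives one copy of
    \<open>?I\<close>, which explains the factor 2.\<close>
  also have "\<dots> = (\<integral>\<^sup>+ x. \<integral>\<^sup>+ c. ennreal B * (?K c x * indicator (cball 0 R) c) * indicator {0..1} x \<partial>lborel \<partial>lborel)"
    by (rule lborel_pair.Fubini') measurable
  also have "\<dots> \<le> (\<integral>\<^sup>+ x. ennreal B * (?I + ?I) * indicator {0..1} (x::real) \<partial>lborel)"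
  proof (intro nn_integral_mono)
    fix x :: real
    have b: "(\<integral>\<^sup>+ c. ennreal (F (circlepath c s x)) * indicator (cball 0 R) c \<partial>lborel) \<le> ?I"
      if "s = r \<or> s = 2 * r" for s
    proof -
      have "norm (e s x) \<le> 2 * r" using that r by (auto simp: e_def circlepath norm_mult)
      then show ?thesis unfolding cp
        by (intro nn_integral_translate_cball_le) auto
    qed
    have "(\<integral>\<^sup>+ c. ennreal B * (?K c x * indicator (cball 0 R) c) * indicator {0..1} x \<partial>lborel)
       = ennreal B * ((\<integral>\<^sup>+ c. ennreal (F (circlepath c (2 * r) x)) * indicator (cball 0 R) c \<partial>lborel)
          + (\<integral>\<^sup>+ c. ennreal (F (circlepath c r x)) * indicator (cball 0 R) c \<partial>lborel)) * indicator {0..1} x"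
      by (simp add: nn_integral_multc nn_integral_cmult nn_integral_add distrib_right)
    also have "\<dots> \<le> ennreal B * (?I + ?I) * indicator {0..1} x"
      by (intro mult_right_mono mult_left_mono add_mono b) auto
    finally show "(\<integral>\<^sup>+ c. ennreal B * (?K c x * indicator (cball 0 R) c) * indicator {0..1} x \<partial>lborel)
      \<le> ennreal B * (?I + ?I) * indicator {0..1} x" .
  qed
  also have "\<dots> = ennreal B * (?I + ?I)"
    by (subst nn_integral_cmult) auto
  also have "\<dots> = ennreal (2 * B) * ?I"
    using B by (simp add: ennreal_mult' mult_2[symmetric] mult_ac)
  finally show ?thesis .
qed

text \<open>\<open>g\<close> is the convolution of \<open>h\<close> with an even kernel of mass
  \<open>I\<close> supported within distance \<open>2 * r\<close>; thus \<open>g w / I\<close> is an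
  average of values of \<open>h\<close> near \<open>w\<close>.\<close>

lemma smoothing_error:
  fixes h :: "complex \<Rightarrow> real"
  assumes r: "0 < r"
    and h: "h \<in> borel_measurable borel" "\<And>c. \<bar>h c\<bar> \<le> B" "\<And>c. norm c > R \<Longrightarrow> h c = 0"
    and close: "\<And>c. norm (c - w) \<le> 2 * r \<Longrightarrow> \<bar>h c - h w\<bar> \<le> \<delta>"
  defines "g \<equiv> \<lambda>w. \<integral>c. h c * log_tent r (w - c) \<partial>lborel" and "I \<equiv> integral\<^sup>L lborel (log_tent r)"
  shows "\<bar>g w - h w * I\<bar> \<le> \<delta> * I" "\<bar>g w\<bar> \<le> B * I"
proof -
  note [measurable] = h(1) and b = log_tent_bounds[OF r] and i = log_tent_integral[OF r]
  have int: "integrable lborel (\<lambda>c. h c * log_tent r (c - w))"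
  proof (rule integrable_bounded_cball)
    have "0 \<le> B" using h(2)[of 0] by linarith
    then show "\<bar>h c * log_tent r (c - w)\<bar> \<le> B * ln 2" for c
      unfolding abs_mult using h(2) b[of "c - w"] by (intro mult_mono) auto
    show "h c * log_tent r (c - w) = 0" if "norm c > R" for c using h(3)[OF that] by simp
  qed measurable
  have g: "g w = (\<integral>c. h c * log_tent r (c - w) \<partial>lborel)"
    unfolding g_def by (subst log_tent_commute) simp
  have "g w - h w * I = (\<integral>c. h c * log_tent r (c - w) \<partial>lborel) - (\<integral>c. h w * log_tent r (c - w) \<partial>lborel)"
    unfolding g I_def using i(4)[of w] by simp
  also have "\<dots> = (\<integral>c. (h c - h w) * log_tent r (c - w) \<partial>lborel)"
    using int i(3)[of w] by (subst Bochner_Integration.integral_diff[symmetric]) (auto simp: left_diff_distrib)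
  also have "\<bar>\<dots>\<bar> \<le> (\<integral>c. \<delta> * log_tent r (c - w) \<partial>lborel)"
  proof (rule integral_abs_bound_integral)
    show "integrable lborel (\<lambda>c. (h c - h w) * log_tent r (c - w))"
      using int i(3)[of w] by (auto simp: left_diff_distrib)
    show "\<bar>(h c - h w) * log_tent r (c - w)\<bar> \<le> \<delta> * log_tent r (c - w)" for c
      using b[of "c - w"] close[of c]
      by (cases "norm (c - w) \<le> 2 * r") (auto simp: abs_mult intro!: mult_right_mono)
  qed (use i in auto)
  also have "\<dots> = \<delta> * I" using i(4)[of w] by (simp add: I_def)
  finally show "\<bar>g w - h w * I\<bar> \<le> \<delta> * I" .
  have "\<bar>g w\<bar> \<le> (\<integral>c. B * log_tent r (c - w) \<partial>lborel)" unfolding g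
  proof (rule integral_abs_bound_integral[OF int])
    show "\<bar>h c * log_tent r (c - w)\<bar> \<le> B * log_tent r (c - w)" for c
      using b[of "c - w"] h(2)[of c] by (auto simp: abs_mult intro!: mult_right_mono)
  qed (use i in auto)
  also have "\<dots> = B * I" using i(4)[of w] by (simp add: I_def)
  finally show "\<bar>g w\<bar> \<le> B * I" .
qed

subsection \<open>Weak convergence in outer probability\<close>


lemma outer_measure_of_le_emeasure:
  "B \<in> sets M \<Longrightarrow> A \<subseteq> B \<Longrightarrow> outer_measure_of M A \<le> emeasure M B"
  using outer_measure_of_mono[of A B M] by simp

text \<open>Outer measures are attained by measurable covers, and the union of two covers covers the
  union.\<close>

lemma outer_measure_of_Un_le:
  assumes "A \<subseteq> space M" "B \<subseteq> space M"
  shows "outer_measure_of M (A \<union> B) \<le> outer_measure_of M A + outer_measure_of M B"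
proof -
  obtain E F where E: "E \<in> sets M" "A \<subseteq> E" "outer_measure_of M A = emeasure M E"
    and F: "F \<in> sets M" "B \<subseteq> F" "outer_measure_of M B = emeasure M F"
    using outer_measure_of_attain[OF assms(1)] outer_measure_of_attain[OF assms(2)] by blast
  have "outer_measure_of M (A \<union> B) \<le> emeasure M (E \<union> F)"
    using E F by (intro outer_measure_of_le_emeasure) auto
  also have "\<dots> \<le> emeasure M E + emeasure M F"
    using E F by (intro emeasure_subadditive) auto
  finally show ?thesis using E F by simp
qed

text \<open>Outer measure spares every measurability proof for events about random measures, and the
  case \<open>\<xi> n \<omega> \<notin> U\<close> is literally what \<open>converges_in_prob\<close>
  asks for.\<close>

definition outer_prob_null :: "(nat \<Rightarrow> 'a measure) \<Rightarrow> (nat \<Rightarrow> 'a \<Rightarrow> bool) \<Rightarrow> bool" where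
  "outer_prob_null M Q \<longleftrightarrow> (\<lambda>n. outer_measure_of (M n) {\<omega> \<in> space (M n). Q n \<omega>}) \<longlonglongrightarrow> 0"

lemma outer_prob_null_mono:
  assumes "outer_prob_null M Q" and "eventually (\<lambda>n. \<forall>\<omega>\<in>space (M n). Q' n \<omega> \<longrightarrow> Q n \<omega>) sequentially"
  shows "outer_prob_null M Q'"
  unfolding outer_prob_null_def
proof (rule tendsto_sandwich[OF _ _ tendsto_const assms(1)[unfolded outer_prob_null_def]])
  show "eventually (\<lambda>n. outer_measure_of (M n) {\<omega> \<in> space (M n). Q' n \<omega>}
      \<le> outer_measure_of (M n) {\<omega> \<in> space (M n). Q n \<omega>}) sequentially"
    using assms(2) by eventually_elim (auto intro!: outer_measure_of_mono)
qed simp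

lemma outer_prob_null_disj:
  assumes "outer_prob_null M Q" "outer_prob_null M Q'"
  shows "outer_prob_null M (\<lambda>n \<omega>. Q n \<omega> \<or> Q' n \<omega>)"
  unfolding outer_prob_null_def
proof (rule tendsto_sandwich[OF _ _ tendsto_const])
  show "(\<lambda>n. outer_measure_of (M n) {\<omega> \<in> space (M n). Q n \<omega>}
      + outer_measure_of (M n) {\<omega> \<in> space (M n). Q' n \<omega>}) \<longlonglongrightarrow> 0"
    using tendsto_add[OF assms[unfolded outer_prob_null_def]] by simp
  show "eventually (\<lambda>n. outer_measure_of (M n) {\<omega> \<in> space (M n). Q n \<omega> \<or> Q' n \<omega>}
      \<le> outer_measure_of (M n) {\<omega> \<in> space (M n). Q n \<omega>}
      + outer_measure_of (M n) {\<omega> \<in> space (M n). Q' n \<omega>}) sequentially"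
  proof (rule always_eventually, rule allI)
    fix n
    have "{\<omega> \<in> space (M n). Q n \<omega> \<or> Q' n \<omega>} = {\<omega> \<in> space (M n). Q n \<omega>} \<union> {\<omega> \<in> space (M n). Q' n \<omega>}"
      by auto
    then show "outer_measure_of (M n) {\<omega> \<in> space (M n). Q n \<omega> \<or> Q' n \<omega>}
      \<le> outer_measure_of (M n) {\<omega> \<in> space (M n). Q n \<omega>}
      + outer_measure_of (M n) {\<omega> \<in> space (M n). Q' n \<omega>}"
      by (simp only:) (rule outer_measure_of_Un_le; blast)
  qed
qed simp

lemma outer_prob_null_False: "outer_prob_null M (\<lambda>n \<omega>. False)"
proof -
  have "outer_measure_of N {} = 0" for N :: "'a measure"
    using outer_measure_of_eq[of "{}" N] by simp
  then show ?thesis by (simp add: outer_prob_null_def)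
qed

text \<open>Induction on the generation of the open set. For an intersection the bad events are
  united, for a union it is enough to follow one member containing \<mu>, and a subbasic set is a
  condition on a single integral.\<close>

lemma converges_in_prob_weak_topologyI:
  fixes \<mu> :: "'b::topological_space measure"
  assumes \<mu>: "\<mu> \<in> space (prob_algebra borel)"
    and \<xi>: "eventually (\<lambda>n. \<forall>\<omega>\<in>space (M n). \<xi> n \<omega> \<in> space (prob_algebra borel)) sequentially"
    and conv: "\<And>(f :: 'b \<Rightarrow> real) \<epsilon>. continuous_on UNIV f \<Longrightarrow> bounded (range f) \<Longrightarrow> 0 < \<epsilon> \<Longrightarrow>
       outer_prob_null M (\<lambda>n \<omega>. \<epsilon> \<le> \<bar>(\<integral>x. f x \<partial>\<xi> n \<omega>) - (\<integral>x. f x \<partial>\<mu>)\<bar>)"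
  shows "converges_in_prob weak_topology M \<xi> \<mu>"
proof -
  have "outer_prob_null M (\<lambda>n \<omega>. \<xi> n \<omega> \<notin> U)" if "openin weak_topology U" "\<mu> \<in> U" for U
    using openin_topology_generated_by[OF that(1)[unfolded weak_topology_def]] that(2)
  proof (induction rule: generate_topology_on.induct)
    case (Int a b)
    then have "outer_prob_null M (\<lambda>n \<omega>. \<xi> n \<omega> \<notin> a \<or> \<xi> n \<omega> \<notin> b)"
      by (intro outer_prob_null_disj) auto
    then show ?case by simp
  next
    case (UN K)
    then obtain S where S: "S \<in> K" "\<mu> \<in> S" by auto
    then have "outer_prob_null M (\<lambda>n \<omega>. \<xi> n \<omega> \<notin> S)" using UN.IH by auto
    then show ?case by (rule outer_prob_null_mono) (use S in auto)
  next
    case (Basis s)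
    then obtain f :: "'b \<Rightarrow> real" and V where s: "s = {N \<in> space (prob_algebra borel). (\<integral>x. f x \<partial>N) \<in> V}"
      and fV: "continuous_on UNIV f" "bounded (range f)" "open V" by blast
    have "(\<integral>x. f x \<partial>\<mu>) \<in> V" using Basis s by simp
    with \<open>open V\<close> obtain \<epsilon> where e: "0 < \<epsilon>" "\<And>y. \<bar>y - (\<integral>x. f x \<partial>\<mu>)\<bar> < \<epsilon> \<Longrightarrow> y \<in> V"
      unfolding open_dist by (auto simp: dist_real_def)
    show ?case
    proof (rule outer_prob_null_mono[OF conv[OF fV(1,2) e(1)]], use \<xi> in eventually_elim)
      case (elim n)
      then show ?case using e(2) unfolding s by (auto simp: not_le[symmetric])
    qed
  qed (simp add: outer_prob_null_False)
  then show ?thesis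
    using \<mu> by (simp add: converges_in_prob_def topspace_weak_topology outer_prob_null_def)
qed

text \<open>A bounded function is cut off outside a large ball; the mass that the cut-off loses is itself
  controlled through the compactly supported cut-off function, so tightness comes for free.\<close>

lemma converges_in_prob_weak_topology_compactly_supportedI:
  fixes \<mu> :: "complex measure"
  assumes \<mu>: "\<mu> \<in> space (prob_algebra borel)"
    and \<xi>: "eventually (\<lambda>n. \<forall>\<omega>\<in>space (M n). \<xi> n \<omega> \<in> space (prob_algebra borel)) sequentially"
    and conv: "\<And>(h :: complex \<Rightarrow> real) R \<epsilon>. continuous_on UNIV h \<Longrightarrow> (\<And>c. norm c > R \<Longrightarrow> h c = 0) \<Longrightarrow> 0 < \<epsilon> \<Longrightarrow>
       outer_prob_null M (\<lambda>n \<omega>. \<epsilon> \<le> \<bar>(\<integral>x. h x \<partial>\<xi> n \<omega>) - (\<integral>x. h x \<partial>\<mu>)\<bar>)"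
  shows "converges_in_prob weak_topology M \<xi> \<mu>"
proof (rule converges_in_prob_weak_topologyI[OF \<mu> \<xi>])
  fix f :: "complex \<Rightarrow> real" and \<epsilon> :: real
  assume f: "continuous_on UNIV f" "bounded (range f)" and e: "0 < \<epsilon>"
  obtain B where B: "0 < B" "\<And>x. \<bar>f x\<bar> \<le> B"
    using f(2) unfolding bounded_pos by auto
  \<comment> \<open>A continuous cut-off: 1 up to radius \<open>N\<close>, linear in between, 0 from
    \<open>N + 1\<close> on.\<close>
  define \<phi> where "\<phi> = (\<lambda>N::nat. \<lambda>x::complex. max 0 (min 1 (real N + 1 - norm x)))"
  have chi: "0 \<le> \<phi> N x" "\<phi> N x \<le> 1" "norm x > real N + 1 \<Longrightarrow> \<phi> N x = 0" for N x
    by (auto simp: \<phi>_def)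
  have chi_cont: "continuous_on UNIV (\<phi> N)" for N
    unfolding \<phi>_def by (intro continuous_intros)
  have mf [measurable]: "f \<in> borel_measurable borel" and mchi [measurable]: "\<phi> N \<in> borel_measurable borel" for N
    using f(1) chi_cont by (auto intro: borel_measurable_continuous_onI)
  have PS: "prob_space P" "sets P = sets borel" if "P \<in> space (prob_algebra borel)" for P :: "complex measure"
    using that by (auto simp: space_prob_algebra)
  have integ: "integrable P f" "integrable P (\<phi> N)" "integrable P (\<lambda>x. f x * \<phi> N x)"
    if "P \<in> space (prob_algebra borel)" for P :: "complex measure" and N
  proof -
    interpret prob_space P using PS[OF that] by simp
    note [measurable_cong] = PS(2)[OF that]
    show "integrable P f" by (rule integrable_const_bound[of _ B]) (use B in auto)
    show "integrable P (\<phi> N)" by (rule integrable_const_bound[of _ 1]) (use chi in auto)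
    show "integrable P (\<lambda>x. f x * \<phi> N x)"
    proof (rule integrable_const_bound[of _ B])
      have "\<bar>f x\<bar> * \<phi> N x \<le> B * 1" for x using B chi[of N x] by (intro mult_mono) auto
      then show "AE x in P. norm (f x * \<phi> N x) \<le> B" using chi by (auto simp: abs_mult)
    qed measurable
  qed
  have cut: "\<bar>(\<integral>x. f x \<partial>P) - (\<integral>x. f x * \<phi> N x \<partial>P)\<bar> \<le> B * (1 - (\<integral>x. \<phi> N x \<partial>P))"
    if P: "P \<in> space (prob_algebra borel)" for P :: "complex measure" and N
  proof -
    interpret prob_space P using PS[OF P] by simp
    have "(\<integral>x. f x \<partial>P) - (\<integral>x. f x * \<phi> N x \<partial>P) = (\<integral>x. f x - f x * \<phi> N x \<partial>P)"
      using integ[OF P] by simp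
    also have "\<bar>\<dots>\<bar> \<le> (\<integral>x. B * (1 - \<phi> N x) \<partial>P)"
    proof (rule integral_abs_bound_integral)
      show "\<bar>f x - f x * \<phi> N x\<bar> \<le> B * (1 - \<phi> N x)" for x
      proof -
        have "f x - f x * \<phi> N x = f x * (1 - \<phi> N x)" by (simp add: algebra_simps)
        then show ?thesis using B(2)[of x] chi(2)[of N x] by (auto simp: abs_mult intro!: mult_right_mono)
      qed
    qed (use integ[OF P] in auto)
    also have "\<dots> = B * (1 - (\<integral>x. \<phi> N x \<partial>P))"
      using integ[OF P] prob_space by simp
    finally show ?thesis .
  qed
  interpret mu: prob_space \<mu> using PS[OF \<mu>] by simp
  have "(\<lambda>N. \<integral>x. \<phi> N x \<partial>\<mu>) \<longlonglongrightarrow> (\<integral>x. 1 \<partial>\<mu>)"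
  proof (rule integral_dominated_convergence[where w = "\<lambda>_. 1"])
    note [measurable_cong] = PS(2)[OF \<mu>]
    show "\<phi> N \<in> borel_measurable \<mu>" for N by measurable
    show "AE x in \<mu>. (\<lambda>N. \<phi> N x) \<longlonglongrightarrow> 1"
    proof (intro AE_I2 tendsto_eventually)
      fix x :: complex
      obtain N0 where "norm x \<le> real N0" using real_arch_simple by blast
      then show "eventually (\<lambda>N. \<phi> N x = 1) sequentially"
        by (intro eventually_sequentiallyI[of N0]) (auto simp: \<phi>_def)
    qed
  qed (use chi in auto)
  then have "eventually (\<lambda>N. \<bar>(\<integral>x. \<phi> N x \<partial>\<mu>) - 1\<bar> < \<epsilon> / (8 * B)) sequentially"
    using e B mu.prob_space unfolding tendsto_iff dist_real_def by simp
  then obtain N where N: "\<bar>(\<integral>x. \<phi> N x \<partial>\<mu>) - 1\<bar> < \<epsilon> / (8 * B)"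
    by (auto simp: eventually_sequentially)
  have c1: "outer_prob_null M (\<lambda>n \<omega>. \<epsilon> / 4 \<le> \<bar>(\<integral>x. f x * \<phi> N x \<partial>\<xi> n \<omega>) - (\<integral>x. f x * \<phi> N x \<partial>\<mu>)\<bar>)"
    by (rule conv[of _ "real N + 1"]) (use e chi f chi_cont in \<open>auto intro!: continuous_intros\<close>)
  have c2: "outer_prob_null M (\<lambda>n \<omega>. \<epsilon> / (8 * B) \<le> \<bar>(\<integral>x. \<phi> N x \<partial>\<xi> n \<omega>) - (\<integral>x. \<phi> N x \<partial>\<mu>)\<bar>)"
    by (rule conv[of _ "real N + 1"]) (use e chi chi_cont B in auto)
  show "outer_prob_null M (\<lambda>n \<omega>. \<epsilon> \<le> \<bar>(\<integral>x. f x \<partial>\<xi> n \<omega>) - (\<integral>x. f x \<partial>\<mu>)\<bar>)"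
  proof (rule outer_prob_null_mono[OF outer_prob_null_disj[OF c1 c2]], use \<xi> in eventually_elim)
    case (elim n)
    show ?case
    proof (intro ballI impI)
      fix \<omega> assume w: "\<omega> \<in> space (M n)" and big: "\<epsilon> \<le> \<bar>(\<integral>x. f x \<partial>\<xi> n \<omega>) - (\<integral>x. f x \<partial>\<mu>)\<bar>"
      have X: "\<xi> n \<omega> \<in> space (prob_algebra borel)" using elim w by auto
      show "\<epsilon> / 4 \<le> \<bar>(\<integral>x. f x * \<phi> N x \<partial>\<xi> n \<omega>) - (\<integral>x. f x * \<phi> N x \<partial>\<mu>)\<bar>
        \<or> \<epsilon> / (8 * B) \<le> \<bar>(\<integral>x. \<phi> N x \<partial>\<xi> n \<omega>) - (\<integral>x. \<phi> N x \<partial>\<mu>)\<bar>"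
      proof (rule ccontr)
        \<comment> \<open>Error budget: the cut-off costs at most \<epsilon> / 4 under
          \<open>\<xi> n \<omega>\<close> and \<epsilon> / 8 under \<mu>, the cut-off integrals
          differ by less than \<epsilon> / 4; the sum is below \<epsilon>.\<close>
        assume neg: "\<not> ?thesis"
        let ?t = "\<epsilon> / (8 * B)"
        have "1 - (\<integral>x. \<phi> N x \<partial>\<xi> n \<omega>) \<le> 2 * ?t" "1 - (\<integral>x. \<phi> N x \<partial>\<mu>) \<le> ?t"
          using neg N by linarith+
        then have "B * (1 - (\<integral>x. \<phi> N x \<partial>\<xi> n \<omega>)) \<le> B * (2 * ?t)" "B * (1 - (\<integral>x. \<phi> N x \<partial>\<mu>)) \<le> B * ?t"
          using B(1) by (auto intro: mult_left_mono simp del: times_divide_eq_right)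
        moreover have "B * (2 * ?t) = \<epsilon> / 4" "B * ?t = \<epsilon> / 8" using B(1) by (auto simp: field_simps)
        ultimately have "B * (1 - (\<integral>x. \<phi> N x \<partial>\<xi> n \<omega>)) \<le> \<epsilon> / 4" "B * (1 - (\<integral>x. \<phi> N x \<partial>\<mu>)) \<le> \<epsilon> / 8"
          by linarith+
        then show False using cut[OF X, of N] cut[OF \<mu>, of N] neg big e by linarith
      qed
    qed
  qed
qed

subsection \<open>Comparison of the empirical measures\<close>


lemma abs_sum_mset_le:
  fixes f :: "'a \<Rightarrow> real" and b :: real
  assumes "\<And>w. \<bar>f w\<bar> \<le> b"
  shows "\<bar>\<Sum>w\<in>#A. f w\<bar> \<le> real (size A) * b"
proof (induction A)
  case (add a A)
  then show ?case using assms[of a] by (simp add: algebra_simps)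
qed simp

text \<open>Replacing \<open>h\<close> by \<open>g / I\<close> at the zeros of \<open>A\<close> and
  at \<open>Z\<close> costs 2 \<delta>, plus \<delta> for at most \<open>k\<close> surplus zeros.
  The random zeros \<open>X\<close> and the change of normalisation from \<open>degree A\<close> to
  \<open>n\<close> each cost \<open>k * B / n\<close>. The last term is Jensen's bound.\<close>

lemma root_average_comparison:
  fixes P A :: "complex poly" and h :: "complex \<Rightarrow> real"
  assumes P: "P \<noteq> 0" "proots P = Z + X" and A: "A \<noteq> 0"
    and sizes: "size Z = n" "size X = k" "n \<ge> 1" "n \<le> degree A" "degree A \<le> n + k"
    and r: "0 < r"
    and h: "h \<in> borel_measurable borel" "\<And>c. \<bar>h c\<bar> \<le> B" "\<And>c. norm c > R \<Longrightarrow> h c = 0"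
    and close: "\<And>c w. norm (c - w) \<le> 2 * r \<Longrightarrow> \<bar>h c - h w\<bar> \<le> \<delta>"
    and small: "(\<integral>\<^sup>+ z. ennreal \<bar>ln (norm (poly A z / poly P z))\<bar> * indicator (cball 0 (R + 2 * r)) z \<partial>lborel) < ennreal y"
  defines "I \<equiv> integral\<^sup>L lborel (log_tent r)"
  shows "\<bar>(\<Sum>w\<in>#proots A. h w) / degree A - (\<Sum>w\<in>#Z. h w) / n\<bar>
    \<le> 2 * \<delta> + real k * (\<delta> + 2 * B) / n + 2 * B * y / (n * I)"
proof -
  let ?d = "real (degree A)" and ?n = "real n"
  have I: "0 < I" using log_tent_integral(2)[OF r] by (simp add: I_def)
  have B: "0 \<le> B" using h(2)[of 0] by linarith
  \<comment> \<open>For negative \<open>y\<close> the right-hand side of \<open>small\<close> would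
    be 0, and nothing is strictly below it.\<close>
  have y: "0 \<le> y" using small by (cases "0 \<le> y") (auto simp: ennreal_neg)
  have \<delta>: "0 \<le> \<delta>" using close[of 0 0] r by simp
  define g where "g = (\<lambda>w. \<integral>c. h c * log_tent r (w - c) \<partial>lborel)"
  have g: "\<bar>g w - h w * I\<bar> \<le> \<delta> * I" "\<bar>g w\<bar> \<le> B * I" for w
    using smoothing_error[OF r h close, where w = w] by (auto simp: g_def I_def)
  have "ennreal \<bar>(\<Sum>w\<in>#proots A. g w) - (\<Sum>w\<in>#proots P. g w)\<bar> \<le> ennreal (2 * B) * ennreal y"
    unfolding g_def using small
    by (intro order.trans[OF smoothed_root_sum_bound[OF P(1) A r h]] mult_left_mono) auto
  also have "\<dots> = ennreal (2 * B * y)" using B y by (simp add: ennreal_mult)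
  finally have 1: "\<bar>(\<Sum>w\<in>#proots A. g w) - ((\<Sum>w\<in>#Z. g w) + (\<Sum>w\<in>#X. g w))\<bar> \<le> 2 * B * y"
    using B y by (simp add: P(2))
  have diff: "(\<Sum>w\<in>#C. g w) - (\<Sum>w\<in>#C. h w) * I = (\<Sum>w\<in>#C. g w - h w * I)" for C
    by (induction C) (auto simp: algebra_simps)
  have 2: "\<bar>(\<Sum>w\<in>#C. g w) - (\<Sum>w\<in>#C. h w) * I\<bar> \<le> size C * (\<delta> * I)" for C
    using abs_sum_mset_le[of "\<lambda>w. g w - h w * I" "\<delta> * I" C] g(1) unfolding diff by simp
  have 3: "\<bar>\<Sum>w\<in>#X. g w\<bar> \<le> k * (B * I)"
    using abs_sum_mset_le[of g "B * I" X] g(2) sizes by simp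
  define SA SZ where "SA = (\<Sum>w\<in>#proots A. h w)" and "SZ = (\<Sum>w\<in>#Z. h w)"
  have "\<bar>SA * I - SZ * I\<bar> \<le> ?d * (\<delta> * I) + ?n * (\<delta> * I) + k * (B * I) + 2 * B * y"
  proof -
    have tri: "\<bar>p' - q'\<bar> \<le> e2 + e3 + e4 + e1"
      if "\<bar>p - (q + s)\<bar> \<le> e1" "\<bar>p - p'\<bar> \<le> e2" "\<bar>q - q'\<bar> \<le> e3" "\<bar>s\<bar> \<le> e4"
      for p q s p' q' e1 e2 e3 e4 :: real
      using that by linarith
    show ?thesis unfolding SA_def SZ_def
      by (rule tri[OF 1 2[of "proots A", unfolded size_proots_complex] 2[of Z, unfolded sizes(1)] 3])
  qed
  also have "\<dots> \<le> (2 * ?n + k) * (\<delta> * I) + k * (B * I) + 2 * B * y"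
  proof -
    have "?d * (\<delta> * I) \<le> (?n + k) * (\<delta> * I)"
      using sizes \<delta> I by (intro mult_right_mono) auto
    then show ?thesis by (simp add: algebra_simps)
  qed
  also have "\<dots> = ((2 * ?n + k) * \<delta> + k * B + 2 * B * y / I) * I"
    using I by (simp add: field_simps)
  also have "SA * I - SZ * I = (SA - SZ) * I" by (simp add: algebra_simps)
  finally have 4: "\<bar>SA - SZ\<bar> \<le> (2 * ?n + k) * \<delta> + k * B + 2 * B * y / I"
    using I by (simp add: abs_mult)
  have n: "0 < ?n" "0 < ?d" "?n \<le> ?d" "?d \<le> ?n + k" using sizes by auto
  have "\<bar>SA\<bar> \<le> ?d * B"
    using abs_sum_mset_le[of h B "proots A"] h(2) by (simp add: SA_def size_proots_complex)
  then have 5: "\<bar>SA / ?d - SA / ?n\<bar> \<le> k * B / ?n"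
  proof -
    have "SA / ?d - SA / ?n = - (SA * (?d - ?n) / (?d * ?n))" using n by (simp add: field_simps)
    then have "\<bar>SA / ?d - SA / ?n\<bar> = \<bar>SA\<bar> * (?d - ?n) / (?d * ?n)"
      using n by (simp add: abs_mult)
    also have "\<dots> \<le> (?d * B) * k / (?d * ?n)"
      using n B \<open>\<bar>SA\<bar> \<le> ?d * B\<close> by (intro divide_right_mono mult_mono) auto
    also have "\<dots> = k * B / ?n" using n by simp
    finally show ?thesis .
  qed
  have "\<bar>SA / ?d - SZ / ?n\<bar> \<le> \<bar>SA / ?d - SA / ?n\<bar> + \<bar>SA - SZ\<bar> / ?n"
  proof -
    have "\<bar>SA - SZ\<bar> / ?n = \<bar>SA / ?n - SZ / ?n\<bar>"
      using n by (simp add: diff_divide_distrib[symmetric])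
    then show ?thesis by linarith
  qed
  also have "\<dots> \<le> k * B / ?n + ((2 * ?n + k) * \<delta> + k * B + 2 * B * y / I) / ?n"
    using n by (intro add_mono 5 divide_right_mono 4) auto
  also have "\<dots> = 2 * \<delta> + real k * (\<delta> + 2 * B) / n + 2 * B * y / (n * I)"
    using n I by (simp add: field_simps)
  finally show ?thesis by (simp add: SA_def SZ_def)
qed

lemma compactly_supported_uniformly_continuous:
  fixes h :: "complex \<Rightarrow> real"
  assumes h: "continuous_on UNIV h" "\<And>c. norm c > R \<Longrightarrow> h c = 0" and "0 < \<delta>"
  obtains B r where "0 < B" "\<And>c. \<bar>h c\<bar> \<le> B" "0 < r"
    "\<And>c w. norm (c - w) \<le> 2 * r \<Longrightarrow> \<bar>h c - h w\<bar> \<le> \<delta>"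
proof -
  have K: "compact (cball (0::complex) (R + 1))" by simp
  have hc: "continuous_on (cball 0 (R + 1)) h" using h(1) by (rule continuous_on_subset) auto
  have "bounded (h ` cball 0 (R + 1))" using compact_continuous_image[OF hc K] by (rule compact_imp_bounded)
  then obtain B where B: "0 < B" "\<And>c. c \<in> cball 0 (R + 1) \<Longrightarrow> \<bar>h c\<bar> \<le> B"
    unfolding bounded_pos by auto
  have "uniformly_continuous_on (cball 0 (R + 1)) h" using hc K by (rule compact_uniformly_continuous)
  then obtain d where d: "0 < d" "\<And>c w. c \<in> cball 0 (R + 1) \<Longrightarrow> w \<in> cball 0 (R + 1) \<Longrightarrow> dist c w < d \<Longrightarrow> dist (h c) (h w) < \<delta>"
    unfolding uniformly_continuous_on_def using \<open>0 < \<delta>\<close> by (metis dist_commute)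
  show ?thesis
  \<comment> \<open>The radius keeps \<open>2 * r\<close> below both \<open>d\<close> and 1. If one
    of two such close points lies beyond \<open>R + 1\<close>, both lie beyond \<open>R\<close>,
    where \<open>h\<close> vanishes.\<close>
  proof (rule that[of B "min d 1 / 4"])
    show "\<bar>h c\<bar> \<le> B" for c
      using B(2)[of c] h(2)[of c] B(1) by (cases "c \<in> cball 0 (R + 1)") auto
    fix c w :: complex assume cw: "norm (c - w) \<le> 2 * (min d 1 / 4)"
    then have cw': "norm (c - w) < d" "norm (c - w) < 1" using d(1) by (auto simp: min_def split: if_splits)
    show "\<bar>h c - h w\<bar> \<le> \<delta>"
    proof (cases "norm c \<le> R + 1 \<and> norm w \<le> R + 1")
      case True
      then show ?thesis using d(2)[of c w] cw' by (simp add: dist_norm)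
    next
      case False
      then have "norm c > R" "norm w > R"
        using cw'(2) norm_triangle_ineq3[of c w] by linarith+
      then show ?thesis using h(2) \<open>0 < \<delta>\<close> by simp
    qed
  qed (use B d in auto)
qed

text \<open>Holds even for the empty multiset: the underlying \<open>pmf\<close> is unspecified
  there but still a probability.\<close>

lemma unif_measure_in_prob_algebra: "unif_measure A \<in> space (prob_algebra borel)"
  unfolding unif_measure_def space_prob_algebra by (auto intro!: measure_pmf.prob_space_distr)

text \<open>Clears the denominator in the conditional density bound. For \<open>b = 0\<close> a
  positive \<open>a\<close> would have an infinite quotient; for infinite \<open>b\<close> the
  product is infinite because \<open>c\<close> is positive.\<close>

lemma ennreal_le_mult_of_divide_le:
  fixes a b :: ennreal
  assumes "a / b \<le> ennreal c" "0 < c"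
  shows "a \<le> ennreal c * b"
proof (cases "b = 0 \<or> b = \<top>")
  case True
  then show ?thesis
  proof
    assume "b = 0"
    then show ?thesis using assms by (cases "a = 0") (auto simp: ennreal_divide_zero top_unique)
  next
    assume "b = \<top>"
    then show ?thesis using assms by (simp add: ennreal_mult_top)
  qed
next
  case False
  then have "a = a / b * b" by (simp add: ennreal_divide_times ennreal_divide_self less_top)
  also have "\<dots> \<le> ennreal c * b" using assms(1) by (rule mult_right_mono) simp
  finally show ?thesis .
qed

text \<open>The quantity to be shown small compared with \<open>n\<close>. For \<open>l = 0\<close>
  the integrand vanishes, also at the zeros by the conventions on division and
  \<open>ln\<close>.\<close>

definition log_quotient_integral ::
    "nat \<Rightarrow> nat \<Rightarrow> (nat \<Rightarrow> complex) \<Rightarrow> nat \<Rightarrow> real \<Rightarrow> (nat \<Rightarrow> complex) \<Rightarrow> ennreal" where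
  "log_quotient_integral n k z l R w = (\<integral>\<^sup>+ x. ennreal \<bar>ln (norm (poly ((pderiv ^^ l) (perturbed_poly n k z w)) x
      / poly (perturbed_poly n k z w) x))\<bar> * indicator (cball 0 R) x \<partial>lborel)"

lemma log_quotient_integral_measurable:
  assumes "{1..k} \<subseteq> I"
  shows "log_quotient_integral n k z l R \<in> borel_measurable (PiM I (\<lambda>_. lborel))"
proof -
  note [measurable] = poly_perturbed_poly_measurable[OF assms, of l n z]
    poly_perturbed_poly_measurable[OF assms, of 0 n z, simplified]
  have [measurable]: "(\<lambda>y. indicator (cball 0 R) (snd y) :: ennreal) \<in> borel_measurable (PiM I (\<lambda>_. lborel :: complex measure) \<Otimes>\<^sub>M (lborel :: complex measure))"
    by (rule measurable_compose[OF measurable_snd]) simp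
  have "(\<lambda>y. ennreal \<bar>ln (norm (poly ((pderiv ^^ l) (perturbed_poly n k z (fst y))) (snd y)
      / poly (perturbed_poly n k z (fst y)) (snd y)))\<bar> * indicator (cball 0 R) (snd y))
      \<in> borel_measurable (PiM I (\<lambda>_. lborel) \<Otimes>\<^sub>M lborel)"
    by measurable
  from lborel.borel_measurable_nn_integral_fst[OF this] show ?thesis
    by (simp add: log_quotient_integral_def[abs_def])
qed

text \<open>|ln| is the sum of its positive and negative parts. The former is bounded for every
  \<open>w\<close> and meets total mass 1, the latter only in expectation.\<close>

lemma (in bounded_conditional_density) expectation_log_quotient_integral:
  assumes I: "{1..k} \<subseteq> I" and l: "l \<le> k" and n: "n \<ge> 1" and s: "0 \<le> s" and R: "0 \<le> R"
  shows "(\<integral>\<^sup>+ w. \<nu> w * log_quotient_integral n k z l R w \<partial>\<Pi>L)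
    \<le> ennreal (real l * (pi * R\<^sup>2 * (ln (real (n + k)) + 1) + 4 * pi)
      + real l * (pi * R\<^sup>2 * (2 * log_plus R + 3 * ln 2 + s + 2 * C + K * (4 * pi * (exp (- s))\<^sup>2))))"
    (is "_ \<le> ennreal (?a + ?b)")
proof -
  let ?q = "\<lambda>w x. poly ((pderiv ^^ l) (perturbed_poly n k z w)) x / poly (perturbed_poly n k z w) x"
  let ?D = "cball (0::complex) R"
  let ?m = "\<lambda>w. \<integral>\<^sup>+ x. ennreal (log_minus (norm (?q w x))) * indicator ?D x \<partial>lborel"
  have a: "0 \<le> ?a" using n by (intro mult_nonneg_nonneg add_nonneg_nonneg) auto
  have b: "0 \<le> ?b"
    using s C_nonneg K_nonneg log_plus_nonneg[of R] by (intro mult_nonneg_nonneg add_nonneg_nonneg) auto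
  note [measurable] = poly_perturbed_poly_measurable[OF I, of l n z]
    poly_perturbed_poly_measurable[OF I, of 0 n z, simplified]
  have mm [measurable]: "?m \<in> borel_measurable \<Pi>L"
  proof -
    have [measurable]: "(\<lambda>y. indicator ?D (snd y) :: ennreal) \<in> borel_measurable (\<Pi>L \<Otimes>\<^sub>M lborel)"
      by (rule measurable_compose[OF measurable_snd]) simp
    have "(\<lambda>y. ennreal (log_minus (norm (?q (fst y) (snd y)))) * indicator ?D (snd y))
        \<in> borel_measurable (\<Pi>L \<Otimes>\<^sub>M lborel)"
      by measurable
    from lborel.borel_measurable_nn_integral_fst[OF this] show ?thesis by simp
  qed
  have "(\<integral>\<^sup>+ w. \<nu> w * log_quotient_integral n k z l R w \<partial>\<Pi>L)
     \<le> (\<integral>\<^sup>+ w. ennreal ?a * \<nu> w + \<nu> w * ?m w \<partial>\<Pi>L)"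
  proof (rule nn_integral_mono)
    fix w
    have mp: "poly p \<in> borel_measurable lborel" for p :: "complex poly" by simp
    have [measurable]: "?q w \<in> borel_measurable lborel"
      using mp by (intro borel_measurable_divide) auto
    have "log_quotient_integral n k z l R w
      = (\<integral>\<^sup>+ x. ennreal (log_plus (norm (?q w x))) * indicator ?D x + ennreal (log_minus (norm (?q w x))) * indicator ?D x \<partial>lborel)"
      unfolding log_quotient_integral_def
    proof (rule nn_integral_cong)
      fix x
      have "ennreal \<bar>ln (norm (?q w x))\<bar> = ennreal (log_plus (norm (?q w x)) + log_minus (norm (?q w x)))"
        by (auto simp: log_plus_eq max_def)
      also have "\<dots> = ennreal (log_plus (norm (?q w x))) + ennreal (log_minus (norm (?q w x)))"
        by (intro ennreal_plus log_plus_nonneg) simp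
      finally show "ennreal \<bar>ln (norm (?q w x))\<bar> * indicator ?D x
        = ennreal (log_plus (norm (?q w x))) * indicator ?D x + ennreal (log_minus (norm (?q w x))) * indicator ?D x"
        by (simp add: distrib_right)
    qed
    also have "\<dots> = (\<integral>\<^sup>+ x. ennreal (log_plus (norm (?q w x))) * indicator ?D x \<partial>lborel) + ?m w"
      by (rule nn_integral_add) measurable
    also have "\<dots> \<le> ennreal ?a + ?m w"
      using nn_integral_log_plus_higher_deriv[of l "perturbed_poly n k z w" R] l n R
      by (intro add_right_mono) (simp add: degree_perturbed_poly)
    finally have "\<nu> w * log_quotient_integral n k z l R w \<le> \<nu> w * (ennreal ?a + ?m w)"
      by (intro mult_left_mono) auto
    then show "\<nu> w * log_quotient_integral n k z l R w \<le> ennreal ?a * \<nu> w + \<nu> w * ?m w"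
      by (simp only: distrib_left mult.commute)
  qed
  also have "\<dots> = ennreal ?a * (\<integral>\<^sup>+ w. \<nu> w \<partial>\<Pi>L) + (\<integral>\<^sup>+ w. \<nu> w * ?m w \<partial>\<Pi>L)"
    by (subst nn_integral_add, measurable, subst nn_integral_cmult, measurable)
  also have "\<dots> \<le> ennreal ?a * 1 + ennreal ?b"
    using expectation_log_minus_quotient[OF I l s R, of n z] unfolding total_mass
    by (intro add_left_mono) simp
  also have "\<dots> = ennreal (?a + ?b)" using a b by (simp add: ennreal_plus del: ennreal_plus[symmetric])
  finally show ?thesis .
qed

text \<open>The two exponentials combine to exp (- n^a), which is at most 1; the dominant term
  divided by \<open>n\<close> is n^(a - 1), and \<open>a < 1\<close> makes it vanish.\<close>

lemma expectation_bound_sublinear: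
  fixes k :: nat and a c0 c1 c2 c3 :: real
  assumes "a < 1" "0 \<le> a"
  shows "(\<lambda>n. (c0 + c1 * ln (real (n + k)) + c2 * real n powr a + c3 * exp (real n powr a) * (exp (- (real n powr a)))\<^sup>2) / real n) \<longlonglongrightarrow> 0"
proof -
  have 1: "(\<lambda>n. c0 / real n) \<longlonglongrightarrow> 0" by real_asymp
  have 2: "(\<lambda>n. c1 * (ln (real (n + k)) / real n)) \<longlonglongrightarrow> c1 * 0"
    by (intro tendsto_mult tendsto_const) real_asymp
  have "(\<lambda>n. real n powr (a - 1)) \<longlonglongrightarrow> 0"
    using assms by (intro tendsto_neg_powr filterlim_real_sequentially) auto
  then have 3: "(\<lambda>n. c2 * real n powr (a - 1)) \<longlonglongrightarrow> c2 * 0"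
    by (intro tendsto_mult tendsto_const)
  have 4: "(\<lambda>n. c3 * exp (- (real n powr a)) / real n) \<longlonglongrightarrow> 0"
  proof (rule Lim_null_comparison[where g = "\<lambda>n. \<bar>c3\<bar> / real n"])
    show "eventually (\<lambda>n. norm (c3 * exp (- (real n powr a)) / real n) \<le> \<bar>c3\<bar> / real n) sequentially"
      by (intro always_eventually allI) (auto simp: abs_mult intro!: divide_right_mono mult_left_le)
    show "(\<lambda>n. \<bar>c3\<bar> / real n) \<longlonglongrightarrow> 0" by real_asymp
  qed
  have "(\<lambda>n. c0 / real n + c1 * (ln (real (n + k)) / real n) + c2 * real n powr (a - 1) + c3 * exp (- (real n powr a)) / real n) \<longlonglongrightarrow> 0"
    using tendsto_add[OF tendsto_add[OF tendsto_add[OF 1 2] 3] 4] by simp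
  then show ?thesis
  proof (rule Lim_transform_eventually)
    show "eventually (\<lambda>n. c0 / real n + c1 * (ln (real (n + k)) / real n) + c2 * real n powr (a - 1) + c3 * exp (- (real n powr a)) / real n
      = (c0 + c1 * ln (real (n + k)) + c2 * real n powr a + c3 * exp (real n powr a) * (exp (- (real n powr a)))\<^sup>2) / real n) sequentially"
      using eventually_gt_at_top[of 0]
    proof eventually_elim
      case (elim n)
      have "exp (real n powr a) * (exp (- (real n powr a)))\<^sup>2 = exp (- (real n powr a))"
        by (simp add: power2_eq_square exp_minus)
      moreover have "real n powr (a - 1) = real n powr a / real n"
        using elim by (simp add: powr_diff)
      ultimately show ?case by (simp add: add_divide_distrib mult.assoc)
    qed
  qed
qed

theorem theorem1p6:
  fixes \<mu> :: "complex measure"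
    and z :: "nat \<Rightarrow> nat \<Rightarrow> complex"
    and k :: nat
    and M :: "nat \<Rightarrow> 'a measure"
    and X :: "nat \<Rightarrow> nat \<Rightarrow> 'a \<Rightarrow> complex"
    and \<nu> :: "nat \<Rightarrow> (nat \<Rightarrow> complex) \<Rightarrow> real"
    and C1 C2 a :: real
  assumes "prob_space \<mu>" and "sets \<mu> = sets borel"
    and "mu_distributed \<mu> z"
    and "k \<ge> 1"
    and "\<And>n. n \<ge> 1 \<Longrightarrow> prob_space (M n)"
    and "\<And>n w. n \<ge> 1 \<Longrightarrow> w \<in> {1..k} \<rightarrow>\<^sub>E UNIV \<Longrightarrow> 0 \<le> \<nu> n w"
    and "\<And>n. n \<ge> 1 \<Longrightarrow>
           distributed (M n) (\<Pi>\<^sub>M j\<in>{1..k}. lborel) (\<lambda>\<omega>. \<lambda>j\<in>{1..k}. X n j \<omega>)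
             (\<lambda>w. ennreal (\<nu> n w))"
    and "C1 > 0" and "C2 > 0" and "0 \<le> a" and "a < 1"
    and "\<And>n. n \<ge> 1 \<Longrightarrow>
           (\<integral>\<^sup>+ w. ennreal ((\<Sum>j=1..k. log_plus (norm (w j))) * \<nu> n w)
              \<partial>(\<Pi>\<^sub>M j\<in>{1..k}. (lborel :: complex measure))) \<le> ennreal C1"
    and "\<And>n i w. n \<ge> 1 \<Longrightarrow> i \<in> {1..k} \<Longrightarrow> w \<in> ({1..k} - {i}) \<rightarrow>\<^sub>E UNIV \<Longrightarrow>
           (SUP v. ennreal (\<nu> n (w(i := v)))) / (\<integral>\<^sup>+ v. ennreal (\<nu> n (w(i := v))) \<partial>lborel)
             \<le> ennreal (C2 * exp (real n powr a))"
    and "((\<lambda>r::real. limsup (\<lambda>n.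
             ereal (\<P>(\<omega> in M n. r \<le> Max ((\<lambda>j. norm (X n j \<omega>)) ` {1..k}))))) \<longlongrightarrow> 0) at_top"
  shows "converges_in_prob weak_topology M
           (\<lambda>n \<omega>. zeros_measure (perturbed_poly n k (z n) (\<lambda>j. X n j \<omega>))) \<mu>
         \<and> (\<forall>l\<in>{1..k}. converges_in_prob weak_topology M
             (\<lambda>n \<omega>. zeros_measure ((pderiv ^^ l) (perturbed_poly n k (z n) (\<lambda>j. X n j \<omega>)))) \<mu>)"
proof -
  let ?L = "\<Pi>\<^sub>M j\<in>{1..k}. (lborel :: complex measure)"
  let ?X = "\<lambda>n \<omega>. \<lambda>j\<in>{1..k}. X n j \<omega>"
  let ?K = "\<lambda>n. C2 * exp (real n powr a)"
  let ?P = "\<lambda>n \<omega>. perturbed_poly n k (z n) (\<lambda>j. X n j \<omega>)"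
  have density: "bounded_conditional_density {1..k} (\<lambda>w. ennreal (\<nu> n w)) C1 (?K n)" if n: "n \<ge> 1" for n
  proof
    note dist = assms(7)[OF n]
    interpret prob_space "M n" by (rule assms(5)[OF n])
    show "(\<lambda>w. ennreal (\<nu> n w)) \<in> borel_measurable ?L"
      using dist by (rule distributed_borel_measurable)
    show "(\<integral>\<^sup>+ w. ennreal (\<nu> n w) \<partial>?L) = 1"
      using distributed_nn_integral[OF dist, of "\<lambda>_. 1"] by (simp add: emeasure_space_1)
    show "(\<integral>\<^sup>+ w. ennreal (\<nu> n w) * ennreal (log_plus (norm (w j))) \<partial>?L) \<le> ennreal C1"
      if j: "j \<in> {1..k}" for j
    proof (rule order.trans[OF nn_integral_mono assms(12)[OF n]])
      fix w assume "w \<in> space ?L"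
      then have "0 \<le> \<nu> n w" using assms(6)[OF n] by (auto simp: space_PiM)
      moreover have "log_plus (norm (w j)) \<le> (\<Sum>j=1..k. log_plus (norm (w j)))"
        using j by (intro member_le_sum) (auto simp: log_plus_nonneg)
      ultimately show "ennreal (\<nu> n w) * ennreal (log_plus (norm (w j))) \<le> ennreal ((\<Sum>j=1..k. log_plus (norm (w j))) * \<nu> n w)"
        by (subst ennreal_mult'[symmetric]) (auto intro!: ennreal_leI mult_left_mono simp: mult.commute)
    qed
    show "ennreal (\<nu> n (w(j := x))) \<le> ennreal (?K n) * (\<integral>\<^sup>+ t. ennreal (\<nu> n (w(j := t))) \<partial>lborel)"
      if "j \<in> {1..k}" "w \<in> ({1..k} - {j}) \<rightarrow>\<^sub>E UNIV" for j w x
    proof -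
      have "ennreal (\<nu> n (w(j := x))) \<le> (SUP v. ennreal (\<nu> n (w(j := v))))"
        by (rule SUP_upper) simp
      also have "\<dots> \<le> ennreal (?K n) * (\<integral>\<^sup>+ t. ennreal (\<nu> n (w(j := t))) \<partial>lborel)"
        using assms(13)[OF n that] assms(9) by (intro ennreal_le_mult_of_divide_le) auto
      finally show ?thesis .
    qed
  qed (use assms in auto)
  have \<mu>: "\<mu> \<in> space (prob_algebra borel)" using assms(1,2) by (simp add: space_prob_algebra)
  have small: "outer_prob_null M (\<lambda>n \<omega>. ennreal (\<delta> * real n) \<le> log_quotient_integral n k (z n) l R (\<lambda>j. X n j \<omega>))"
    if l: "l \<le> k" and R: "0 \<le> R" and \<delta>: "0 < \<delta>" for l R \<delta>
    unfolding outer_prob_null_def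
  proof (rule tendsto_sandwich[OF _ _ tendsto_const])
    let ?Y = "\<lambda>n. log_quotient_integral n k (z n) l R"
    \<comment> \<open>The expectation bound at level \<open>s = real n powr a\<close>, matched to
      the growth of \<open>?K n\<close>.\<close>
    define bnd where "bnd = (\<lambda>n::nat. real l * (pi * R\<^sup>2 * (ln (real (n + k)) + 1) + 4 * pi)
      + real l * (pi * R\<^sup>2 * (2 * log_plus R + 3 * ln 2 + real n powr a + 2 * C1
        + ?K n * (4 * pi * (exp (- (real n powr a)))\<^sup>2))))"
    \<comment> \<open>The joint law lives on vectors restricted to \<open>{1..k}\<close>, while the
      polynomial is built from the unrestricted family.\<close>
    have X_cong: "?Y n (?X n \<omega>) = ?Y n (\<lambda>j. X n j \<omega>)" for n \<omega>
    proof -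
      have "perturbed_poly n k (z n) (?X n \<omega>) = ?P n \<omega>" by (rule perturbed_poly_cong) simp
      then show ?thesis by (simp add: log_quotient_integral_def)
    qed
    have mY: "?Y n \<in> borel_measurable ?L" for n by (rule log_quotient_integral_measurable) simp
    \<comment> \<open>Markov's inequality for the area integral, whose expectation is at most
      \<open>bnd n\<close>.\<close>
    have bound: "outer_measure_of (M n) {\<omega> \<in> space (M n). ennreal (\<delta> * real n) \<le> ?Y n (\<lambda>j. X n j \<omega>)}
       \<le> ennreal (1 / \<delta> * (bnd n / real n))" if n: "n \<ge> 1" for n
    proof -
      interpret bounded_conditional_density "{1..k}" "\<lambda>w. ennreal (\<nu> n w)" C1 "?K n" by (rule density[OF n])
      note dist = assms(7)[OF n]
      have mYX: "(\<lambda>\<omega>. ?Y n (\<lambda>j. X n j \<omega>)) \<in> borel_measurable (M n)"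
        using measurable_compose[OF distributed_measurable[OF dist] mY[of n]] by (simp add: X_cong del: One_nat_def)
      have dn: "0 < \<delta> * real n" "0 < n" using \<delta> n by simp_all
      have iff: "ennreal (\<delta> * real n) \<le> y \<longleftrightarrow> 1 \<le> ennreal (1 / (\<delta> * real n)) * y" for y
      proof -
        have "ennreal (\<delta> * real n) \<le> y \<longleftrightarrow> ennreal (1 / (\<delta> * real n)) * ennreal (\<delta> * real n) \<le> ennreal (1 / (\<delta> * real n)) * y"
          using dn by (subst ennreal_mult_le_mult_iff) auto
        also have "ennreal (1 / (\<delta> * real n)) * ennreal (\<delta> * real n) = 1"
          using dn \<delta> n by (subst ennreal_mult'[symmetric]) auto
        finally show ?thesis .
      qed
      have "{\<omega> \<in> space (M n). ennreal (\<delta> * real n) \<le> ?Y n (\<lambda>j. X n j \<omega>)} \<in> sets (M n)"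
        using mYX by measurable
      then have "outer_measure_of (M n) {\<omega> \<in> space (M n). ennreal (\<delta> * real n) \<le> ?Y n (\<lambda>j. X n j \<omega>)}
        = emeasure (M n) {\<omega> \<in> space (M n). 1 \<le> ennreal (1 / (\<delta> * real n)) * ?Y n (\<lambda>j. X n j \<omega>)}"
        by (simp add: iff)
      also have "\<dots> \<le> ennreal (1 / (\<delta> * real n)) * (\<integral>\<^sup>+ \<omega>. ?Y n (\<lambda>j. X n j \<omega>) \<partial>M n)"
      proof -
        have "(\<integral>\<^sup>+ \<omega>. ?Y n (\<lambda>j. X n j \<omega>) * indicator (space (M n)) \<omega> \<partial>M n) = (\<integral>\<^sup>+ \<omega>. ?Y n (\<lambda>j. X n j \<omega>) \<partial>M n)"
          by (rule nn_integral_cong) simp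
        then show ?thesis
          using nn_integral_Markov_inequality[of "\<lambda>\<omega>. ?Y n (\<lambda>j. X n j \<omega>)" "space (M n)" "M n" "ennreal (1 / (\<delta> * real n))"] mYX
          by simp
      qed
      also have "(\<integral>\<^sup>+ \<omega>. ?Y n (\<lambda>j. X n j \<omega>) \<partial>M n) = (\<integral>\<^sup>+ w. ennreal (\<nu> n w) * ?Y n w \<partial>?L)"
        using distributed_nn_integral[OF dist mY[of n]] by (simp add: X_cong del: One_nat_def)
      also have "\<dots> \<le> ennreal (bnd n)"
        unfolding bnd_def using expectation_log_quotient_integral[of k l n "real n powr a" R "z n"] l R n by simp
      also have "ennreal (1 / (\<delta> * real n)) * ennreal (bnd n) = ennreal (1 / \<delta> * (bnd n / real n))"
        using dn by (subst ennreal_mult'[symmetric]) auto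
      finally show ?thesis by (simp add: mult_left_mono)
    qed
    have "(\<lambda>n. bnd n / real n) \<longlonglongrightarrow> 0"
    proof -
      have "bnd = (\<lambda>n. (real l * (pi * R\<^sup>2 + 4 * pi) + real l * (pi * R\<^sup>2 * (2 * log_plus R + 3 * ln 2 + 2 * C1)))
         + (real l * (pi * R\<^sup>2)) * ln (real (n + k)) + (real l * (pi * R\<^sup>2)) * real n powr a
         + (real l * (pi * R\<^sup>2) * C2 * 4 * pi) * exp (real n powr a) * (exp (- (real n powr a)))\<^sup>2)"
        by (auto simp: bnd_def algebra_simps)
      then show ?thesis using expectation_bound_sublinear[OF assms(11,10)] by simp
    qed
    then have "(\<lambda>n. ennreal (1 / \<delta> * (bnd n / real n))) \<longlonglongrightarrow> ennreal (1 / \<delta> * 0)"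
      by (intro tendsto_ennrealI tendsto_mult tendsto_const)
    then show "(\<lambda>n. ennreal (1 / \<delta> * (bnd n / real n))) \<longlonglongrightarrow> 0" by simp
    show "eventually (\<lambda>n. outer_measure_of (M n) {\<omega> \<in> space (M n). ennreal (\<delta> * real n) \<le> ?Y n (\<lambda>j. X n j \<omega>)}
       \<le> ennreal (1 / \<delta> * (bnd n / real n))) sequentially"
      using eventually_ge_at_top[of 1] by eventually_elim (rule bound)
  qed simp
  \<comment> \<open>The range of \<open>l\<close> includes 0, so the claim on the polynomial itself
    is a special case.\<close>
  have main: "converges_in_prob weak_topology M (\<lambda>n \<omega>. zeros_measure ((pderiv ^^ l) (?P n \<omega>))) \<mu>"
    if l: "l \<le> k" for l
  proof (rule converges_in_prob_weak_topology_compactly_supportedI[OF \<mu>])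
    show "eventually (\<lambda>n. \<forall>\<omega>\<in>space (M n). zeros_measure ((pderiv ^^ l) (?P n \<omega>)) \<in> space (prob_algebra borel)) sequentially"
      by (simp add: zeros_measure_def unif_measure_in_prob_algebra)
    fix h :: "complex \<Rightarrow> real" and R \<epsilon> :: real
    assume h: "continuous_on UNIV h" "\<And>c. norm c > R \<Longrightarrow> h c = 0" and \<epsilon>: "0 < \<epsilon>"
    \<comment> \<open>The support radius \<open>R\<close> may be negative, but a disc of nonnegative
      radius is required below.\<close>
    define R' where "R' = max R 0"
    have h0: "h c = 0" if "norm c > R'" for c using h(2) that by (simp add: R'_def)
    define \<delta> where "\<delta> = \<epsilon> / 16"
    have "0 < \<delta>" using \<epsilon> by (simp add: \<delta>_def)
    then obtain B r where B: "0 < B" "\<And>c. \<bar>h c\<bar> \<le> B" and r: "0 < r"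
      and close: "\<And>c w. norm (c - w) \<le> 2 * r \<Longrightarrow> \<bar>h c - h w\<bar> \<le> \<delta>"
      using compactly_supported_uniformly_continuous[OF h(1) h0] by metis
    have mh: "h \<in> borel_measurable borel" using h(1) by (rule borel_measurable_continuous_onI)
    define I where "I = integral\<^sup>L lborel (log_tent r)"
    have I: "0 < I" using log_tent_integral(2)[OF r] by (simp add: I_def)
    \<comment> \<open>Chosen so that the Jensen term is exactly \<epsilon> / 8. With 2 \<delta> =
      \<epsilon> / 8 and the vanishing term below \<epsilon> / 8, the averages differ by less than
      \<epsilon> / 2; the deterministic array adds less than \<epsilon> / 4.\<close>
    define \<eta> where "\<eta> = \<epsilon> * I / (16 * B)"
    have \<eta>: "0 < \<eta>" using \<epsilon> I B by (simp add: \<eta>_def)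
    have Rr: "0 \<le> R' + 2 * r" using r by (simp add: R'_def)
    let ?Z = "\<lambda>n. image_mset (z n) (mset_set {1..n})"
    have "(\<lambda>n. \<integral>x. h x \<partial>unif_measure (?Z n)) \<longlonglongrightarrow> (\<integral>x. h x \<partial>\<mu>)"
      using assms(3) h(1) B(2) unfolding mu_distributed_def weakly_converges_def
      by (auto simp: bounded_iff)
    from tendstoD[OF this, of "\<epsilon> / 4"]
    have ev1: "eventually (\<lambda>n. \<bar>(\<integral>x. h x \<partial>unif_measure (?Z n)) - (\<integral>x. h x \<partial>\<mu>)\<bar> < \<epsilon> / 4) sequentially"
      using \<epsilon> by (simp add: dist_real_def)
    have "(\<lambda>n. real k * (\<delta> + 2 * B) / real n) \<longlonglongrightarrow> 0" by real_asymp
    from tendstoD[OF this, of "\<epsilon> / 8"]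
    have ev2: "eventually (\<lambda>n. \<bar>real k * (\<delta> + 2 * B) / real n\<bar> < \<epsilon> / 8) sequentially"
      using \<epsilon> by (simp add: dist_real_def)
    show "outer_prob_null M (\<lambda>n \<omega>. \<epsilon> \<le> \<bar>(\<integral>x. h x \<partial>zeros_measure ((pderiv ^^ l) (?P n \<omega>))) - (\<integral>x. h x \<partial>\<mu>)\<bar>)"
    proof (rule outer_prob_null_mono[OF small[OF l Rr \<eta>]],
        use ev1 ev2 eventually_ge_at_top[of 1] in eventually_elim)
      case (elim n)
      show ?case
      proof (intro ballI impI)
        fix \<omega>
        assume big: "\<epsilon> \<le> \<bar>(\<integral>x. h x \<partial>zeros_measure ((pderiv ^^ l) (?P n \<omega>))) - (\<integral>x. h x \<partial>\<mu>)\<bar>"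
        show "ennreal (\<eta> * real n) \<le> log_quotient_integral n k (z n) l (R' + 2 * r) (\<lambda>j. X n j \<omega>)"
        proof (rule ccontr)
          assume neg: "\<not> ?thesis"
          let ?A = "(pderiv ^^ l) (?P n \<omega>)"
          have dA: "degree ?A = n + k - l" "?A \<noteq> 0"
            using pderiv_funpow_nonzero[OF perturbed_poly_nonzero, of l n k "z n" "\<lambda>j. X n j \<omega>"] l
            by (auto simp: degree_perturbed_poly)
          have "\<bar>(\<Sum>w\<in>#proots ?A. h w) / degree ?A - (\<Sum>w\<in>#?Z n. h w) / n\<bar>
            \<le> 2 * \<delta> + real k * (\<delta> + 2 * B) / n + 2 * B * (\<eta> * n) / (n * I)"
            unfolding I_def
          proof (rule root_average_comparison[OF perturbed_poly_nonzero proots_perturbed_poly dA(2) _ _ _ _ _ r mh B(2) h0 close])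
            show "(\<integral>\<^sup>+ x. ennreal \<bar>ln (norm (poly ?A x / poly (?P n \<omega>) x))\<bar> * indicator (cball 0 (R' + 2 * r)) x \<partial>lborel)
              < ennreal (\<eta> * real n)"
              using neg by (simp add: log_quotient_integral_def not_le)
          qed (use l elim dA in auto)
          moreover have "2 * B * (\<eta> * n) / (n * I) = \<epsilon> / 8"
            using B I elim(3) by (simp add: \<eta>_def)
          moreover have "x < \<epsilon> / 2" if "x \<le> 2 * \<delta> + y + t" "t = \<epsilon> / 8" "\<bar>y\<bar> < \<epsilon> / 8" for x y t
            using that \<epsilon> unfolding \<delta>_def by linarith
          ultimately have close_sums: "\<bar>(\<Sum>w\<in>#proots ?A. h w) / degree ?A - (\<Sum>w\<in>#?Z n. h w) / n\<bar> < \<epsilon> / 2"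
            using elim(2) by blast
          have int_A: "(\<integral>x. h x \<partial>zeros_measure ?A) = (\<Sum>w\<in>#proots ?A. h w) / degree ?A"
          proof -
            \<comment> \<open>The degree \<open>n + k - l\<close> is at least \<open>n\<close>, so
              there are zeros to average over.\<close>
            have "0 < size (proots ?A)" using dA l elim(3) by (simp add: size_proots_complex)
            then have "proots ?A \<noteq> {#}" by auto
            then show ?thesis
              unfolding zeros_measure_def by (subst integral_unif_measure[OF _ mh]) (simp_all add: size_proots_complex)
          qed
          have int_Z: "(\<integral>x. h x \<partial>unif_measure (?Z n)) = (\<Sum>w\<in>#?Z n. h w) / n"
            using elim(3) by (subst integral_unif_measure[OF _ mh]) (auto simp: mset_set_empty_iff)
          have "\<bar>x - u\<bar> < \<epsilon>" if "\<bar>x - y\<bar> < \<epsilon> / 2" "\<bar>y - u\<bar> < \<epsilon> / 4" for x y u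
            using that \<epsilon> by linarith
          from this[OF close_sums[folded int_A int_Z] elim(1)] show False
            using big by (meson not_less)
        qed
      qed
    qed
  qed
  show ?thesis using main[of 0] main by auto
qed

end
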